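(* For every integer $n \ge 18$, $$\operatorname{ex}_3(n,K_3) = \left\lfloor \left( \frac{n-2}{2} \right)^2 \right\rfloor .$$
   Context: All graphs are finite, simple and undirected, and need not be connected. For a graph $G$ and an integer $k\ge 1$, the $k$-distance graph $G_k$ is the graph on vertex set $V(G)$ in which two vertices are adjacent if and only if their distance in $G$ is exactly $k$ (vertices in different components of $G$ are not adjacent in $G_k$). For a fixed graph $H$, define $$\operatorname{ex}_k(n,H):=\max\{|E(G_k)| : |V(G)|=n \text{ and } G_k \text{ is } H\text{-free}\},$$ where $H$-free means containing no subgraph isomorphic to $H$. *)

theory Defs
  imports Complex_Main "Graph_Theory.Graph_Theory"
begin

text \<open>
  A finite simple undirected graph is a \<^locale>\<open>pair_graph\<close>: a finite symmetric loop-free set of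
  ordered pairs over a finite vertex set. An undirected edge \<open>uv\<close> is thus represented by the two arcs
  \<open>(u,v)\<close> and \<open>(v,u)\<close>, and edges have to be counted as unordered pairs.
\<close>

definition uedges :: "'a pair_pre_digraph \<Rightarrow> 'a set set" where
  "uedges G = (\<lambda>(u, v). {u, v}) ` parcs G"

text \<open>
  \<open>\<mu>\<close> is the library's shortest-path cost; with unit weights it is the graph distance, and it is
  \<open>\<infinity>\<close> for vertices in different components.
\<close>

definition graph_dist :: "'a pair_pre_digraph \<Rightarrow> 'a \<Rightarrow> 'a \<Rightarrow> ereal" where
  "graph_dist G u v = wf_digraph.\<mu> (with_proj G) (\<lambda>_. 1) u v"

definition dist_graph :: "nat \<Rightarrow> 'a pair_pre_digraph \<Rightarrow> 'a pair_pre_digraph" where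
  "dist_graph k G =
    \<lparr> pverts = pverts G,
      parcs = {(u, v). u \<in> pverts G \<and> v \<in> pverts G \<and> graph_dist G u v = ereal (real k)} \<rparr>"

definition graph_free :: "'b pair_pre_digraph \<Rightarrow> 'a pair_pre_digraph \<Rightarrow> bool" where
  "graph_free H G \<longleftrightarrow> \<not> (\<exists>S. subgraph S (with_proj G) \<and> digraph_iso (with_proj H) S)"

text \<open>
  Every graph on \<open>n\<close> vertices has an isomorphic copy with vertices of type \<open>nat\<close>, so the maximum
  ranges over all \<open>n\<close>-vertex graphs.
\<close>

definition ex_dist :: "nat \<Rightarrow> nat \<Rightarrow> 'b pair_pre_digraph \<Rightarrow> nat" where
  "ex_dist k n H =
    Max {card (uedges (dist_graph k G)) | G :: nat pair_pre_digraph.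
           pair_graph G \<and> card (pverts G) = n \<and> graph_free H (dist_graph k G)}"

definition complete_graph :: "nat \<Rightarrow> nat pair_pre_digraph" where
  "complete_graph r = \<lparr> pverts = {..<r}, parcs = {(u, v). u < r \<and> v < r \<and> u \<noteq> v} \<rparr>"

lemma complete_graph_is_complete: "complete_digraph r (with_proj (complete_graph r))"
  by (auto simp: complete_digraph_pair_def complete_graph_def)

lemma graph_dist_eq_iff:
  assumes "pair_graph G"
  shows "graph_dist G u v = ereal (real k) \<longleftrightarrow>
    (\<exists>p. pre_digraph.awalk (with_proj G) u p v \<and> length p = k) \<and>
    (\<forall>p. pre_digraph.awalk (with_proj G) u p v \<longrightarrow> k \<le> length p)"
proof -
  interpret pair_graph G by fact
  have cost: "awalk_cost (\<lambda>_. 1) p = real (length p)" for p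
    by (induction p) auto
  have mu: "graph_dist G u v = (INF p\<in>{p. awalk u p v}. ereal (real (length p)))"
    unfolding graph_dist_def \<mu>_def cost ..
  show ?thesis
  proof (cases "\<exists>p. awalk u p v")
    case False
    then show ?thesis by (simp add: mu top_ereal_def)
  next
    case True
    then obtain q where q: "awalk u q v" "\<And>p. awalk u p v \<Longrightarrow> length q \<le> length p"
      using ex_has_least_nat[of "\<lambda>p. awalk u p v" _ length] by blast
    have "graph_dist G u v = ereal (real (length q))"
      unfolding mu
    proof (rule antisym)
      show "(INF p\<in>{p. awalk u p v}. ereal (real (length p))) \<le> ereal (real (length q))"
        using q(1) by (intro INF_lower) simp
      show "ereal (real (length q)) \<le> (INF p\<in>{p. awalk u p v}. ereal (real (length p)))"
        using q(2) by (intro INF_greatest) simp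
    qed
    then show ?thesis using q by (auto intro: le_antisym)
  qed
qed

end

theory Submission
  imports Defs
begin

text \<open>
  Write \<open>E\<close> for adjacency in the graph and \<open>H\<close> for the relation "at distance three", assumed
  triangle-free. If \<open>u x y v\<close> is a shortest path, then \<open>x\<close> and \<open>y\<close> are \<open>H\<close>-adjacent to neither
  \<open>u\<close> nor \<open>v\<close>, so \<open>deg u + deg v \<le> n - 2\<close> for every \<open>H\<close>-edge. If all these sums were at most
  \<open>n - 4\<close>, averaging would give at most \<open>n (n - 4) / 4\<close> edges. So fix an \<open>H\<close>-edge \<open>uv\<close> whose sum
  is maximal, namely \<open>n - 2\<close> or \<open>n - 3\<close>, and let \<open>A\<close>, \<open>B\<close> be the \<open>H\<close>-neighbourhoods of \<open>v\<close>, \<open>u\<close>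
  and \<open>C\<close> the two or three remaining vertices, \<open>x\<close> and \<open>y\<close> among them. The sets \<open>A\<close> and \<open>B\<close> are
  \<open>H\<close>-independent, hence it remains to weigh the \<open>H\<close>-edges at \<open>C\<close> against the pairs in \<open>A \<times> B\<close>
  that are not \<open>H\<close>-edges. Such pairs come from shortest paths: a path from \<open>a \<in> A\<close> to \<open>v\<close> that
  avoids \<open>C\<close> passes through \<open>B\<close>, and \<open>a\<close> is at distance at most two from the vertices it meets there.
  For \<open>|C| = 2\<close> this yields an injection of the edges at \<open>C\<close> into the missing pairs. For \<open>|C| = 3\<close>,
  maximality of the degree sum shows in addition that every vertex of \<open>A \<union> B\<close> has at least as many
  missing pairs as it has \<open>H\<close>-neighbours in \<open>C\<close>, and the case distinction is on how the third vertex
  \<open>z\<close> of \<open>C\<close> is attached to the path. Equality is attained by double brooms.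
\<close>

section \<open>Vertices at distance three\<close>

lemma card_filter_eq_sum: "finite S \<Longrightarrow> card {p \<in> S. Q p} = (\<Sum>p\<in>S. of_bool (Q p))"
  by (simp add: Collect_conj_eq Int_commute)

locale dist_three =
  fixes V :: "'a set" and E :: "'a \<Rightarrow> 'a \<Rightarrow> bool"
  assumes finite_V: "finite V"
    and E_in_V: "E p q \<Longrightarrow> p \<in> V"
    and E_sym: "E p q \<Longrightarrow> E q p"
    and E_irrefl: "\<not> E p p"
begin

text \<open>Distance exactly three, unfolded into excluded short walks and one walk of length three,
  so that all distance arguments become first-order in \<open>E\<close>.\<close>

definition H :: "'a \<Rightarrow> 'a \<Rightarrow> bool" where
  "H p q \<longleftrightarrow> p \<noteq> q \<and> \<not> E p q \<and> (\<forall>r. E p r \<longrightarrow> \<not> E r q) \<and> (\<exists>r s. E p r \<and> E r s \<and> E s q)"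

definition deg :: "'a \<Rightarrow> nat" where
  "deg p = card {q. H p q}"

definition nonadj :: "'a set \<Rightarrow> 'a \<Rightarrow> nat" where
  "nonadj T p = card {q \<in> T. \<not> H p q}"

definition adj :: "'a set \<Rightarrow> 'a \<Rightarrow> nat" where
  "adj T p = card {q \<in> T. H p q}"

definition miss :: "'a set \<Rightarrow> 'a set \<Rightarrow> nat" where
  "miss S T = (\<Sum>p\<in>S. nonadj T p)"

lemma H_sym: "H p q \<Longrightarrow> H q p"
  unfolding H_def using E_sym by metis

lemma H_commute: "H p q \<longleftrightarrow> H q p"
  using H_sym by blast

lemma H_not_E: "H p q \<Longrightarrow> \<not> E p q"
  unfolding H_def by blast

lemma not_H_E2: "E p r \<Longrightarrow> E r q \<Longrightarrow> \<not> H p q"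
  unfolding H_def by blast

lemma H_irrefl: "\<not> H p p"
  unfolding H_def by blast

lemma H_path: "H p q \<Longrightarrow> \<exists>r s. E p r \<and> E r s \<and> E s q"
  unfolding H_def by blast

lemma H_in_V: "H p q \<Longrightarrow> p \<in> V"
  unfolding H_def using E_in_V by blast

lemma finite_H: "finite {q. H p q}"
  by (rule finite_subset[OF _ finite_V]) (use H_in_V H_sym in blast)

lemma miss_commute:
  assumes "finite S" "finite T"
  shows "miss S T = miss T S"
proof -
  have "miss S T = (\<Sum>p\<in>S. \<Sum>q\<in>T. of_bool (\<not> H p q))"
    unfolding miss_def nonadj_def using assms by (auto simp: Collect_conj_eq Int_commute intro!: sum.cong)
  also have "\<dots> = (\<Sum>q\<in>T. \<Sum>p\<in>S. of_bool (\<not> H p q))"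
    by (rule sum.swap)
  also have "\<dots> = miss T S"
    unfolding miss_def nonadj_def using assms
    by (auto simp: Collect_conj_eq Int_commute H_commute intro!: sum.cong)
  finally show ?thesis .
qed

lemma sum_adj_swap:
  assumes "finite S" "finite T"
  shows "(\<Sum>p\<in>S. adj T p) = (\<Sum>q\<in>T. adj S q)"
proof -
  have "(\<Sum>p\<in>S. adj T p) = (\<Sum>p\<in>S. \<Sum>q\<in>T. of_bool (H p q))"
    unfolding adj_def using assms by (auto simp: Collect_conj_eq Int_commute intro!: sum.cong)
  also have "\<dots> = (\<Sum>q\<in>T. \<Sum>p\<in>S. of_bool (H p q))"
    by (rule sum.swap)
  also have "\<dots> = (\<Sum>q\<in>T. adj S q)"
    unfolding adj_def using assms
    by (auto simp: Collect_conj_eq Int_commute H_commute intro!: sum.cong)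
  finally show ?thesis .
qed

lemma adj_empty: "adj {} p = 0"
  by (simp add: adj_def)

lemma adj_insert:
  assumes "finite T" "q \<notin> T"
  shows "adj (insert q T) p = of_bool (H p q) + adj T p"
proof -
  have "{r \<in> insert q T. H p r} = (if H p q then insert q {r \<in> T. H p r} else {r \<in> T. H p r})"
    by auto
  thus ?thesis using assms by (simp add: adj_def)
qed

lemma adj_nonadj: "finite T \<Longrightarrow> adj T p + nonadj T p = card T"
  unfolding adj_def nonadj_def
  by (subst card_Un_disjoint[symmetric]) (auto intro!: arg_cong[of _ _ card])

lemma miss_split:
  assumes "finite S" "R \<subseteq> S"
  shows "miss S T = miss R T + miss (S - R) T"
  unfolding miss_def using sum.subset_diff[OF assms(2,1), of "nonadj T"] by simp

lemma miss_mono: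
  assumes "finite S" "finite T" "S' \<subseteq> S" "T' \<subseteq> T"
  shows "miss S' T' \<le> miss S T"
proof -
  have "miss S' T' \<le> miss S' T"
    unfolding miss_def nonadj_def using assms by (intro sum_mono card_mono) auto
  also have "\<dots> \<le> miss S T"
    unfolding miss_def using assms by (intro sum_mono2) auto
  finally show ?thesis .
qed

lemma nonadj_pos:
  assumes "finite T" "q \<in> T" "\<not> H p q"
  shows "1 \<le> nonadj T p"
proof -
  have "card {q} \<le> nonadj T p"
    unfolding nonadj_def using assms by (intro card_mono) auto
  thus ?thesis by simp
qed

lemma nonadj_ge:
  assumes "finite T" "S \<subseteq> T" "\<And>q. q \<in> S \<Longrightarrow> \<not> H p q"
  shows "card S \<le> nonadj T p"
  unfolding nonadj_def using assms by (intro card_mono) auto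

lemma miss_ge_card:
  assumes "finite T" "\<And>p. p \<in> S \<Longrightarrow> \<exists>q\<in>T. \<not> H p q"
  shows "card S \<le> miss S T"
proof -
  have "(\<Sum>p\<in>S. 1) \<le> miss S T"
    unfolding miss_def using assms nonadj_pos by (intro sum_mono) blast
  thus ?thesis by simp
qed

lemma card_pairs_le_miss:
  assumes "finite S" "finite T" "R \<subseteq> {(p, q). p \<in> S \<and> q \<in> T \<and> \<not> H p q}"
  shows "card R \<le> miss S T"
proof -
  have eq: "{(p, q). p \<in> S \<and> q \<in> T \<and> \<not> H p q} = Sigma S (\<lambda>p. {q \<in> T. \<not> H p q})"
    by auto
  have "card R \<le> card (Sigma S (\<lambda>p. {q \<in> T. \<not> H p q}))"
    using assms unfolding eq by (intro card_mono) auto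
  also have "\<dots> = miss S T"
    unfolding miss_def nonadj_def using assms by (subst card_SigmaI) auto
  finally show ?thesis .
qed

text \<open>Summing \<open>deg p + deg q\<close> over the ordered \<open>H\<close>-edges gives twice
  the sum of the squared degrees; Cauchy-Schwarz compares this with the square of the degree
  sum.\<close>

lemma degree_sum_le:
  assumes "\<And>p q. H p q \<Longrightarrow> deg p + deg q \<le> L"
  shows "2 * (\<Sum>p\<in>V. deg p) \<le> card V * L"
proof -
  let ?T = "\<Sum>p\<in>V. deg p"
  have inner: "(\<Sum>q | H p q. deg p) = deg p * deg p" for p
    by (simp add: deg_def)
  have nb: "{q. H p q} = {q \<in> V. H p q}" for p
    using H_in_V H_sym by blast
  have swap: "(\<Sum>p\<in>V. \<Sum>q | H p q. deg q) = (\<Sum>p\<in>V. \<Sum>q | H p q. deg p)"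
    unfolding nb using finite_V
    by (subst sum.swap_restrict) (auto simp: H_commute)
  have "2 * (\<Sum>p\<in>V. deg p * deg p) = (\<Sum>p\<in>V. \<Sum>q | H p q. deg p + deg q)"
    by (simp only: sum.distrib swap inner mult_2)
  also have "\<dots> \<le> (\<Sum>p\<in>V. \<Sum>q | H p q. L)"
    using assms by (intro sum_mono) auto
  also have "\<dots> = ?T * L"
    by (simp add: deg_def sum_distrib_right)
  finally have sq: "2 * (\<Sum>p\<in>V. deg p * deg p) \<le> ?T * L" .
  have "2 * (r * s) \<le> r * r + s * s" for r s :: nat
  proof -
    have "0 \<le> (int r - int s) * (int r - int s)"
      by simp
    hence "int (2 * (r * s)) \<le> int (r * r + s * s)"
      by (simp add: algebra_simps)
    thus ?thesis
      by (simp only: of_nat_le_iff)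
  qed
  hence "(\<Sum>p\<in>V. \<Sum>q\<in>V. 2 * (deg p * deg q)) \<le> (\<Sum>p\<in>V. \<Sum>q\<in>V. deg p * deg p + deg q * deg q)"
    by (intro sum_mono) auto
  hence "?T * ?T \<le> card V * (\<Sum>p\<in>V. deg p * deg p)"
    by (simp add: sum.distrib sum_product flip: sum_distrib_left)
  hence "2 * (?T * ?T) \<le> card V * (2 * (\<Sum>p\<in>V. deg p * deg p))"
    by simp
  also have "\<dots> \<le> card V * (?T * L)"
    using sq by (rule mult_le_mono2)
  finally have "?T * (2 * ?T) \<le> ?T * (card V * L)"
    by (simp only: ac_simps)
  thus ?thesis
    by (cases "?T = 0") simp_all
qed

end

locale triangle_free_dist_three = dist_three +
  assumes triangle_free: "H p q \<Longrightarrow> H q r \<Longrightarrow> \<not> H p r"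

section \<open>The partition induced by an edge\<close>

locale base_edge = triangle_free_dist_three +
  fixes u x y v :: 'a and A B C :: "'a set"
  assumes Eux: "E u x" and Exy: "E x y" and Eyv: "E y v" and Huv: "H u v"
    and A_eq: "A = {a. H a v}" and B_eq: "B = {b. H b u}" and C_eq: "C = V - (A \<union> B)"
begin

text \<open>Reversing the path exchanges \<open>u\<close> with \<open>v\<close>, \<open>x\<close>
  with \<open>y\<close> and \<open>A\<close> with \<open>B\<close>, so facts about \<open>A\<close>
  carry over to \<open>B\<close>.\<close>

lemma mirror: "base_edge V E v y x u B A C"
  by unfold_locales (simp_all add: A_eq B_eq C_eq Un_commute E_sym[OF Eux] E_sym[OF Exy] E_sym[OF Eyv] H_sym[OF Huv])

lemma uA: "u \<in> A" and vB: "v \<in> B"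
  by (simp_all add: A_eq B_eq Huv H_sym[OF Huv])

lemma AB_disjoint: "A \<inter> B = {}"
  using triangle_free[OF _ H_sym[OF Huv]] unfolding A_eq B_eq by blast

lemma subset_V: "A \<subseteq> V" "B \<subseteq> V" "C \<subseteq> V"
  using H_in_V unfolding A_eq B_eq C_eq by blast+

lemma finite_ABC: "finite A" "finite B" "finite C"
  using subset_V finite_V finite_subset by blast+

lemma V_eq: "V = A \<union> B \<union> C"
  using subset_V by (auto simp: C_eq)

lemma card_V: "card V = card A + card B + card C"
proof -
  have "(A \<union> B) \<inter> C = {}" by (auto simp: C_eq)
  thus ?thesis unfolding V_eq using finite_ABC AB_disjoint by (simp add: card_Un_disjoint)
qed

lemma A_indep: "a \<in> A \<Longrightarrow> a' \<in> A \<Longrightarrow> \<not> H a a'"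
  using triangle_free[OF _ H_sym, of a v a'] unfolding A_eq by blast

lemma B_indep: "b \<in> B \<Longrightarrow> b' \<in> B \<Longrightarrow> \<not> H b b'"
  using triangle_free[OF _ H_sym, of b u b'] unfolding B_eq by blast

lemma xyC: "x \<in> C" "y \<in> C"
proof -
  have "\<not> H x v" "\<not> H x u" "\<not> H y v" "\<not> H y u"
    using not_H_E2 H_not_E Eux Exy Eyv E_sym by metis+
  thus "x \<in> C" "y \<in> C"
    using E_in_V[OF Exy] E_in_V[OF Eyv] unfolding C_eq A_eq B_eq by blast+
qed

lemma xB: "b \<in> B \<Longrightarrow> \<not> E b x"
  using not_H_E2[OF _ E_sym[OF Eux]] unfolding B_eq by blast

lemma yA: "a \<in> A \<Longrightarrow> \<not> E a y"
  using not_H_E2[OF _ Eyv] unfolding A_eq by blast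

lemma not_Exv: "\<not> E x v" and not_Euy: "\<not> E u y"
  using Huv Eux Eyv not_H_E2 by blast+

lemma not_Hxy: "\<not> H x y"
  using Exy H_not_E by blast

lemma deg_A: "a \<in> A \<Longrightarrow> deg a = adj B a + adj C a"
proof -
  assume "a \<in> A"
  hence eq: "{q. H a q} = {q \<in> B. H a q} \<union> {q \<in> C. H a q}"
    using A_indep H_in_V H_sym unfolding C_eq by blast
  show ?thesis
    unfolding deg_def adj_def eq using finite_ABC by (intro card_Un_disjoint) (auto simp: C_eq)
qed

lemma deg_B: "b \<in> B \<Longrightarrow> deg b = adj A b + adj C b"
proof -
  assume "b \<in> B"
  hence eq: "{q. H b q} = {q \<in> A. H b q} \<union> {q \<in> C. H b q}"
    using B_indep H_in_V H_sym unfolding C_eq by blast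
  show ?thesis
    unfolding deg_def adj_def eq using finite_ABC by (intro card_Un_disjoint) (auto simp: C_eq)
qed

lemma deg_eq: "deg c = adj A c + adj B c + adj C c"
proof -
  have eq: "{q. H c q} = ({q \<in> A. H c q} \<union> {q \<in> B. H c q}) \<union> {q \<in> C. H c q}"
    using H_in_V H_sym unfolding C_eq by blast
  have "card ({q \<in> A. H c q} \<union> {q \<in> B. H c q}) = adj A c + adj B c"
    unfolding adj_def using finite_ABC AB_disjoint by (intro card_Un_disjoint) auto
  moreover have "deg c = card ({q \<in> A. H c q} \<union> {q \<in> B. H c q}) + adj C c"
    unfolding deg_def adj_def eq using finite_ABC by (intro card_Un_disjoint) (auto simp: C_eq)
  ultimately show ?thesis by simp
qed

lemma deg_u: "deg u = card B" and deg_v: "deg v = card A"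
  unfolding deg_def A_eq B_eq by (simp_all only: H_commute[of _ u] H_commute[of _ v])

text \<open>A handshake count: the \<open>H\<close>-edges between \<open>A\<close> and
  \<open>B\<close> are all pairs but the missing ones. The factors 2 count each edge from both ends;
  the last sum does so by itself.\<close>

lemma degree_count:
  "(\<Sum>p\<in>V. deg p) + 2 * miss A B =
    2 * (card A * card B) + 2 * (\<Sum>a\<in>A. adj C a) + 2 * (\<Sum>b\<in>B. adj C b) + (\<Sum>c\<in>C. adj C c)"
proof -
  have A: "(\<Sum>a\<in>A. deg a) + miss A B = card A * card B + (\<Sum>a\<in>A. adj C a)"
  proof -
    have "(\<Sum>a\<in>A. deg a) + miss A B = (\<Sum>a\<in>A. adj C a + (adj B a + nonadj B a))"
      using deg_A by (simp add: miss_def sum.distrib)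
    thus ?thesis using adj_nonadj finite_ABC by (simp add: sum.distrib)
  qed
  have B: "(\<Sum>b\<in>B. deg b) + miss A B = card A * card B + (\<Sum>b\<in>B. adj C b)"
  proof -
    have "(\<Sum>b\<in>B. deg b) + miss B A = (\<Sum>b\<in>B. adj C b + (adj A b + nonadj A b))"
      using deg_B by (simp add: miss_def sum.distrib)
    thus ?thesis using adj_nonadj finite_ABC miss_commute by (simp add: sum.distrib mult.commute)
  qed
  have C: "(\<Sum>c\<in>C. deg c) = (\<Sum>a\<in>A. adj C a) + (\<Sum>b\<in>B. adj C b) + (\<Sum>c\<in>C. adj C c)"
    using sum_adj_swap finite_ABC by (simp add: deg_eq sum.distrib)
  have "(\<Sum>p\<in>V. deg p) = (\<Sum>a\<in>A. deg a) + (\<Sum>b\<in>B. deg b) + (\<Sum>c\<in>C. deg c)"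
  proof -
    have "(A \<union> B) \<inter> C = {}" unfolding C_eq by blast
    thus ?thesis unfolding V_eq using finite_ABC AB_disjoint by (simp add: sum.union_disjoint)
  qed
  thus ?thesis using A B C by simp
qed

text \<open>The inner vertices of a shortest path from \<open>a\<close> to \<open>v\<close> are too close to \<open>v\<close> to lie in \<open>A\<close>.\<close>

lemma path_to_v:
  assumes "a \<in> A"
  shows "\<exists>s t. E a s \<and> E s t \<and> E t v \<and> s \<in> B \<union> (C - {y}) \<and> t \<in> B \<union> (C - {x})"
proof -
  obtain s t where st: "E a s" "E s t" "E t v"
    using assms H_path unfolding A_eq by blast
  moreover have "s \<notin> A" "t \<notin> A"
    using st not_H_E2 H_not_E unfolding A_eq by blast+
  moreover have "s \<noteq> y" "t \<noteq> x" "s \<in> V" "t \<in> V"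
    using st assms yA not_Exv E_in_V by blast+
  ultimately show ?thesis unfolding C_eq by blast
qed

end

section \<open>Edges missing two vertices\<close>

locale base_edge2 = base_edge +
  assumes C2: "C = {x, y}"
begin

lemma mirror2: "base_edge2 V E v y x u B A C"
  using mirror C2 by (simp add: base_edge2_def base_edge2_axioms_def insert_commute)

lemma crossing:
  assumes "a \<in> A" "\<not> E a x"
  shows "\<exists>s\<in>B. E a s"
  using path_to_v[OF assms(1)] assms(2) C2 by blast

text \<open>If \<open>t\<close> were not adjacent to \<open>y\<close>, the mirrored
  \<open>crossing\<close> would give it a neighbour in \<open>A\<close>, within two steps of
  \<open>v\<close> through \<open>t\<close>.\<close>

lemma nbr_v: "t \<in> B \<Longrightarrow> E t v \<Longrightarrow> E t y"
  using base_edge2.crossing[OF mirror2] not_H_E2 E_sym unfolding A_eq by blast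

text \<open>On a shortest path \<open>a s t v\<close>, both \<open>s\<close> and \<open>t\<close>
  are too close to \<open>a\<close>. If \<open>t\<close> lies in \<open>B\<close>, it is adjacent to
  \<open>y\<close> by \<open>nbr_v\<close>; if \<open>t = y\<close>, then \<open>s\<close>
  serves.\<close>

lemma nonadj_near:
  assumes "a \<in> A" "\<not> E a x"
  obtains t where "t \<in> B" "E t y" "\<not> H a t"
proof -
  obtain s t where st: "E a s" "E s t" "E t v" "s \<in> B" "t \<in> B \<or> t = y"
    using path_to_v[OF assms(1)] assms(2) C2 by blast
  hence "\<not> H a s" "\<not> H a t"
    using H_not_E not_H_E2 by blast+
  thus thesis using that st nbr_v by blast
qed

text \<open>Because of \<open>H a y\<close>, a shortest path \<open>a s t v\<close> has
  \<open>s\<close> in \<open>B\<close> not adjacent to \<open>y\<close>. Hence \<open>t\<close> lies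
  in \<open>B\<close>, is adjacent to \<open>y\<close>, and links \<open>s\<close> to
  \<open>y\<close> in two steps.\<close>

lemma nonadj_far:
  assumes "a \<in> A" "H a y"
  obtains s where "s \<in> B" "\<not> E s y" "\<not> H a s" "\<not> H s y"
proof -
  obtain s t where st: "E a s" "E s t" "E t v" "s \<in> B \<or> s = x" "t \<in> B \<or> t = y"
    using path_to_v[OF assms(1)] C2 by blast
  have s: "\<not> E s y" "s \<in> B"
    using st Exy assms(2) not_H_E2 by blast+
  hence "E t y" using nbr_v st by blast
  thus thesis using that[OF s(2,1)] st not_H_E2 H_not_E by blast
qed

lemma far_not_E: "a \<in> A \<Longrightarrow> H a x \<or> H a y \<Longrightarrow> \<not> E a x"
  using Exy H_not_E not_H_E2 by blast

lemma adj_C: "adj C p = of_bool (H p x) + of_bool (H p y)"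
proof -
  have "x \<noteq> y" using Exy E_irrefl by blast
  thus ?thesis by (simp add: C2 adj_insert adj_empty)
qed

lemma sum_adj_C:
  assumes "finite S"
  shows "(\<Sum>p\<in>S. adj C p) = card {p \<in> S. H p x \<or> H p y} + card {p \<in> S. H p x \<and> H p y}"
  unfolding card_filter_eq_sum[OF assms] sum.distrib[symmetric]
  by (intro sum.cong) (auto simp: adj_C)

text \<open>A vertex with an \<open>H\<close>-neighbour in \<open>C\<close> receives a missing pair
  from \<open>nonadj_near\<close>, and a second one from \<open>nonadj_far\<close> if it is
  \<open>H\<close>-adjacent to both \<open>x\<close> and \<open>y\<close>. All these pairs are
  distinct.\<close>

lemma sum_adj_le_miss: "(\<Sum>a\<in>A. adj C a) + (\<Sum>b\<in>B. adj C b) \<le> miss A B"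
proof -
  interpret M: base_edge2 V E v y x u B A C by (rule mirror2)
  define f1 where "f1 a = (SOME t. t \<in> B \<and> E t y \<and> \<not> H a t)" for a
  define f2 where "f2 a = (SOME s. s \<in> B \<and> \<not> E s y \<and> \<not> H a s \<and> \<not> H s y)" for a
  define g1 where "g1 b = (SOME t. t \<in> A \<and> E t x \<and> \<not> H b t)" for b
  define g2 where "g2 b = (SOME s. s \<in> A \<and> \<not> E s x \<and> \<not> H b s \<and> \<not> H s x)" for b
  have f1: "f1 a \<in> B \<and> E (f1 a) y \<and> \<not> H a (f1 a)" if "a \<in> A" "\<not> E a x" for a
    unfolding f1_def by (rule someI_ex) (use nonadj_near[OF that] in metis)
  have g1: "g1 b \<in> A \<and> E (g1 b) x \<and> \<not> H b (g1 b)" if "b \<in> B" "\<not> E b y" for b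
    unfolding g1_def by (rule someI_ex) (use M.nonadj_near[OF that] in metis)
  have f2: "f2 a \<in> B \<and> \<not> E (f2 a) y \<and> \<not> H a (f2 a) \<and> \<not> H (f2 a) y" if "a \<in> A" "H a y" for a
    unfolding f2_def by (rule someI_ex) (use nonadj_far[OF that] in metis)
  have g2: "g2 b \<in> A \<and> \<not> E (g2 b) x \<and> \<not> H b (g2 b) \<and> \<not> H (g2 b) x" if "b \<in> B" "H b x" for b
    unfolding g2_def by (rule someI_ex) (use M.nonadj_far[OF that] in metis)
  let ?P = "{a \<in> A. H a x \<or> H a y}" and ?P2 = "{a \<in> A. H a x \<and> H a y}"
  let ?Q = "{b \<in> B. H b x \<or> H b y}" and ?Q2 = "{b \<in> B. H b x \<and> H b y}"
  define R1 where "R1 = (\<lambda>a. (a, f1 a)) ` ?P"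
  define R2 where "R2 = (\<lambda>a. (a, f2 a)) ` ?P2"
  define R3 where "R3 = (\<lambda>b. (g1 b, b)) ` ?Q"
  define R4 where "R4 = (\<lambda>b. (g2 b, b)) ` ?Q2"
  note defs = R1_def R2_def R3_def R4_def
  have cards: "card R1 = card ?P" "card R2 = card ?P2" "card R3 = card ?Q" "card R4 = card ?Q2"
    unfolding defs by (auto intro!: card_image inj_onI)
  have fin: "finite R1" "finite R2" "finite R3" "finite R4"
    unfolding defs using finite_ABC by auto
  have pE: "\<not> E a x" if "a \<in> ?P" for a using far_not_E that by blast
  have qE: "\<not> E b y" if "b \<in> ?Q" for b using M.far_not_E that by blast
  \<comment> \<open>\<open>E\<close>-adjacency of the \<open>B\<close>-component to \<open>y\<close>
    separates \<open>R1\<close> from \<open>R2\<close> and \<open>R4\<close>; that of the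
    \<open>A\<close>-component to \<open>x\<close> separates \<open>R3\<close> from the others;
    \<open>H\<close>-adjacency of the \<open>A\<close>-component to \<open>x\<close> separates
    \<open>R2\<close> from \<open>R4\<close>.\<close>
  have "R1 \<inter> R2 = {}" "R1 \<inter> R3 = {}" "R1 \<inter> R4 = {}" "R2 \<inter> R3 = {}" "R2 \<inter> R4 = {}" "R3 \<inter> R4 = {}"
    unfolding defs using pE qE f1 f2 g1 g2 by (safe; force)+
  hence "card (R1 \<union> R2 \<union> (R3 \<union> R4)) = card R1 + card R2 + (card R3 + card R4)"
    using fin by (simp add: card_Un_disjoint Int_Un_distrib Int_Un_distrib2)
  moreover have "card (R1 \<union> R2 \<union> (R3 \<union> R4)) \<le> miss A B"
    unfolding defs
    by (rule card_pairs_le_miss[OF finite_ABC(1,2)])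
      (use pE qE f1 f2 g1 g2 H_commute in auto)
  ultimately show ?thesis
    using cards sum_adj_C[OF finite_ABC(1)] sum_adj_C[OF finite_ABC(2)] by simp
qed

lemma degree_sum_le2: "(\<Sum>p\<in>V. deg p) \<le> 2 * (card A * card B)"
proof -
  have "(\<Sum>c\<in>C. adj C c) = 0"
    unfolding adj_C using not_Hxy H_irrefl H_commute[of y x] by (simp add: C2)
  thus ?thesis using degree_count sum_adj_le_miss by linarith
qed

end

section \<open>Edges missing three vertices\<close>

text \<open>What an \<open>H\<close>-edge of degree sum \<open>card V - 3\<close> supplies if the
  bound fails: \<open>adj_le_A\<close> and \<open>adj_le_B\<close> express maximality of the sum,
  and the \<open>H\<close>-edges at \<open>C\<close> outnumber the missing pairs by the three stated
  margins.\<close>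

locale excess_edge = base_edge +
  fixes z :: 'a
  assumes C3: "C = {x, y, z}" and zx: "z \<noteq> x" and zy: "z \<noteq> y"
    and adj_le_A: "a \<in> A \<Longrightarrow> adj C a \<le> nonadj B a"
    and adj_le_B: "b \<in> B \<Longrightarrow> adj C b \<le> nonadj A b"
    and excess_A: "miss A B + card A + 1 \<le>
      (\<Sum>a\<in>A. adj C a) + (\<Sum>b\<in>B. adj C b) + (of_bool (H x z) + of_bool (H y z))"
    and excess_B: "miss A B + card B + 1 \<le>
      (\<Sum>a\<in>A. adj C a) + (\<Sum>b\<in>B. adj C b) + (of_bool (H x z) + of_bool (H y z))"
    and excess_8: "miss A B + 8 \<le>
      (\<Sum>a\<in>A. adj C a) + (\<Sum>b\<in>B. adj C b) + (of_bool (H x z) + of_bool (H y z))"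
begin

lemma mirror3: "excess_edge V E v y x u B A C z"
proof -
  interpret M: base_edge V E v y x u B A C by (rule mirror)
  have "miss B A = miss A B" using miss_commute finite_ABC by blast
  thus ?thesis
    using C3 zx zy adj_le_A adj_le_B excess_A excess_B excess_8
    by unfold_locales auto
qed

text \<open>The number of \<open>H\<close>-edges inside \<open>C\<close>, since \<open>x\<close> and
  \<open>y\<close> are adjacent in \<open>E\<close>.\<close>

abbreviation e :: nat where "e \<equiv> of_bool (H x z) + of_bool (H y z)"

lemma adj_C: "adj C p = of_bool (H p x) + of_bool (H p y) + of_bool (H p z)"
proof -
  have "x \<noteq> y" using Exy E_irrefl by blast
  thus ?thesis using zx zy by (simp add: C3 adj_insert adj_empty)
qed

lemma V_cases: "p \<in> V \<Longrightarrow> p \<in> A \<or> p \<in> B \<or> p = x \<or> p = y \<or> p = z"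
  using V_eq C3 by blast

lemma adj_u: "adj C u = 0"
proof -
  have "{q \<in> C. H u q} = {}"
    using H_sym unfolding C_eq B_eq by blast
  thus ?thesis unfolding adj_def by (simp only: card.empty)
qed

lemma z_notin: "z \<notin> A" "z \<notin> B"
  using C3 unfolding C_eq by blast+

lemma adj_le_3: "adj C p \<le> 3"
  by (simp add: adj_C)

lemma adj_le_2: "1 \<le> e \<Longrightarrow> adj C p \<le> 2"
  using triangle_free[of p x z] triangle_free[of p y z] by (auto simp: adj_C of_bool_def split: if_splits)

lemma common_nbr:
  assumes "H p q" "H p c" shows "\<not> H q c"
  using triangle_free[OF H_sym[OF assms(2)] assms(1)] H_commute[of q c] by blast

text \<open>Two neighbourhoods of total size at least four in the three-element set \<open>C\<close>
  share a vertex, which would close a triangle.\<close>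

lemma not_H_of_adj:
  assumes "4 \<le> adj C p + adj C q" "1 \<le> adj C p" "1 \<le> adj C q"
  shows "\<not> H p q"
  using assms common_nbr[of p q] by (auto simp: adj_C of_bool_def split: if_splits)

lemma sum_adj_le: "(\<Sum>a\<in>A. adj C a) \<le> miss A B" "(\<Sum>b\<in>B. adj C b) \<le> miss A B"
proof -
  show "(\<Sum>a\<in>A. adj C a) \<le> miss A B"
    unfolding miss_def by (intro sum_mono adj_le_A)
  show "(\<Sum>b\<in>B. adj C b) \<le> miss A B"
    unfolding miss_commute[OF finite_ABC(1,2)] unfolding miss_def by (intro sum_mono adj_le_B)
qed

lemma sum_adj_le_card: "finite S \<Longrightarrow>
  (\<Sum>p\<in>S. adj C p) \<le> card {p \<in> S. 1 \<le> adj C p} + 2 * card {p \<in> S. 2 \<le> adj C p}"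
  unfolding card_filter_eq_sum sum_distrib_left sum.distrib[symmetric]
  using adj_le_3 by (intro sum_mono) (auto simp: of_bool_def not_le intro: order_trans[OF adj_le_3])

lemma miss_split3:
  assumes "A1 \<subseteq> A" "B1 \<subseteq> B"
  shows "miss A B = miss A1 B1 + miss (A - A1) B1 + (\<Sum>b\<in>B - B1. nonadj A b)"
proof -
  have fin: "finite B1" using finite_ABC assms finite_subset by blast
  have "miss A B = miss B1 A + miss (B - B1) A"
    using miss_commute[OF finite_ABC(1,2)] miss_split[OF finite_ABC(2) assms(2)] by simp
  also have "miss B1 A = miss A B1"
    using miss_commute finite_ABC fin by blast
  also have "\<dots> = miss A1 B1 + miss (A - A1) B1"
    by (rule miss_split[OF finite_ABC(1) assms(1)])
  finally show ?thesis by (simp add: miss_def)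
qed

text \<open>All \<open>H\<close>-neighbours of \<open>u\<close> lie in \<open>B\<close>, so
  \<open>u\<close> contributes nothing; the unit saved here is decisive in the later counts.\<close>

lemma sum_adj_with_u:
  assumes "S \<subseteq> A" "u \<in> S" "\<And>a. a \<in> S \<Longrightarrow> adj C a \<le> 1"
  shows "(\<Sum>a\<in>S. adj C a) + 1 \<le> card S"
proof -
  have fin: "finite S" using assms finite_ABC finite_subset by blast
  have "(\<Sum>a\<in>S. adj C a) = (\<Sum>a\<in>S - {u}. adj C a)"
    using fin assms(2) adj_u by (simp add: sum.remove)
  also have "\<dots> \<le> (\<Sum>a\<in>S - {u}. 1)"
    using assms(3) by (intro sum_mono) auto
  finally show ?thesis
    using card_Suc_Diff1[OF fin assms(2)] by simp
qed

text \<open>Each vertex of \<open>A\<close> pays for one of its edges to \<open>C\<close>, a missing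
  pair in \<open>B1\<close> for a second, and only a third edge stays unpaid. What is left of
  \<open>excess_A\<close> concerns \<open>B - B1\<close>; the 2 combines its strictness with the
  unit saved at \<open>u\<close>.\<close>

lemma split_A:
  assumes A1: "A1 \<subseteq> A" and B1: "B1 \<subseteq> B" and u: "u \<in> A1"
    and kA1: "\<And>a. a \<in> A1 \<Longrightarrow> adj C a \<le> 1"
    and good: "(\<Sum>b\<in>B1. adj C b) \<le> miss A1 B1"
    and mA: "\<And>a. a \<in> A - A1 \<Longrightarrow> 2 \<le> adj C a \<Longrightarrow> \<exists>b\<in>B1. \<not> H a b"
  shows "(\<Sum>b\<in>B - B1. nonadj A b) + 2 \<le> card {a \<in> A - A1. adj C a = 3} + (\<Sum>b\<in>B - B1. adj C b) + e"
proof -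
  have fin: "finite A1" "finite B1" "finite (A - A1)" "finite (B - B1)"
    using finite_ABC A1 B1 finite_subset by blast+
  have "adj C a \<le> (1 + nonadj B1 a) + of_bool (adj C a = 3)" if "a \<in> A - A1" for a
  proof (cases "2 \<le> adj C a")
    case True
    hence "1 \<le> nonadj B1 a" using mA[OF that] nonadj_pos fin by blast
    thus ?thesis using adj_le_3[of a] by auto
  qed simp
  hence "(\<Sum>a\<in>A - A1. adj C a) \<le> (\<Sum>a\<in>A - A1. (1 + nonadj B1 a) + of_bool (adj C a = 3))"
    by (rule sum_mono)
  also have "\<dots> = card (A - A1) + miss (A - A1) B1 + card {a \<in> A - A1. adj C a = 3}"
    unfolding card_filter_eq_sum[OF fin(3)] miss_def sum.distrib by simp
  finally have 1: "(\<Sum>a\<in>A - A1. adj C a) \<le> card (A - A1) + miss (A - A1) B1 + card {a \<in> A - A1. adj C a = 3}" .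
  have 2: "(\<Sum>a\<in>A1. adj C a) + 1 \<le> card A1"
    by (rule sum_adj_with_u[OF A1 u kA1])
  have 3: "(\<Sum>a\<in>A. adj C a) = (\<Sum>a\<in>A - A1. adj C a) + (\<Sum>a\<in>A1. adj C a)"
    "(\<Sum>b\<in>B. adj C b) = (\<Sum>b\<in>B - B1. adj C b) + (\<Sum>b\<in>B1. adj C b)"
    using A1 B1 finite_ABC by (simp_all add: sum.subset_diff)
  have 4: "card A = card (A - A1) + card A1"
    using card_Diff_subset[OF fin(1) A1] card_mono[OF finite_ABC(1) A1] by simp
  show ?thesis
    using excess_A 1 2 3 4 miss_split3[OF A1 B1] good by linarith
qed

text \<open>The missing pairs in \<open>(A - A1) \<times> B1\<close> and in \<open>A1 \<times> (B - B1)\<close> pay for one edge at each outer vertex;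
  two vertices with at least two neighbours in \<open>C\<close> each share one, which yields a third family.\<close>

lemma no_split:
  assumes A1: "A1 \<subseteq> A" and B1: "B1 \<subseteq> B" and u: "u \<in> A1"
    and kA1: "\<And>a. a \<in> A1 \<Longrightarrow> adj C a \<le> 1"
    and kB1: "\<And>b. b \<in> B1 \<Longrightarrow> adj C b \<le> 1"
    and good: "(\<Sum>b\<in>B1. adj C b) \<le> miss A1 B1"
    and mA: "\<And>a. a \<in> A - A1 \<Longrightarrow> 2 \<le> adj C a \<Longrightarrow> \<exists>b\<in>B1. \<not> H a b"
    and mB: "\<And>b. b \<in> B - B1 \<Longrightarrow> 2 \<le> adj C b \<Longrightarrow> \<exists>a\<in>A1. \<not> H b a"
    and e: "e \<le> 1"
  shows False
proof -
  have fin: "finite A1" "finite B1" "finite (A - A1)" "finite (B - B1)"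
    using finite_ABC A1 B1 finite_subset by blast+
  let ?A2 = "{a \<in> A. 2 \<le> adj C a}" and ?B2 = "{b \<in> B. 2 \<le> adj C b}"
  let ?A3 = "{a \<in> A - A1. adj C a = 3}"
  have SI: "(\<Sum>b\<in>B - B1. nonadj A b) + 2 \<le> card ?A3 + (\<Sum>b\<in>B - B1. adj C b) + e"
    using split_A[OF A1 B1 u kA1 good mA] by blast
  have leB: "(\<Sum>b\<in>S. adj C b) \<le> (\<Sum>b\<in>S. nonadj A b)" if "S \<subseteq> B" for S
    using that adj_le_B by (intro sum_mono) auto
  have A3_A2: "card ?A3 \<le> card ?A2"
    using finite_ABC by (intro card_mono) auto
  have e0: "e = 0"
  proof (rule ccontr)
    assume "e \<noteq> 0"
    hence "1 \<le> e" by linarith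
    hence "adj C a \<noteq> 3" for a using adj_le_2[of a] by linarith
    hence "card ?A3 = 0" by simp
    thus False using SI e leB[of "B - B1"] by auto
  qed
  have A3: "2 \<le> card ?A3" using SI e0 leB[of "B - B1"] by auto
  have B2_sub: "?B2 \<subseteq> B - B1" using kB1 by fastforce
  \<comment> \<open>\<open>b\<close> misses all of \<open>?A2\<close> by
    \<open>not_H_of_adj\<close>, and moreover a vertex of \<open>A1\<close>, which lies outside
    \<open>?A2\<close> by \<open>kA1\<close>.\<close>
  have nB2: "card ?A2 + 1 \<le> nonadj A b" if b: "b \<in> ?B2" for b
  proof -
    obtain a where a: "a \<in> A1" "\<not> H b a" using mB b B2_sub by blast
    have "card (insert a ?A2) \<le> nonadj A b"
      using a A1 b not_H_of_adj[of b] finite_ABC by (intro nonadj_ge) auto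
    moreover have "a \<notin> ?A2" using kA1[OF a(1)] by auto
    ultimately show ?thesis using finite_ABC by simp
  qed
  \<comment> \<open>A vertex of \<open>?B2\<close> has at least \<open>card ?A2 + 1 - 3\<close> more
    missing pairs than edges to \<open>C\<close>, while \<open>SI\<close> allows a total surplus of
    at most \<open>card ?A2 - 2\<close>.\<close>
  have "adj C b + (card ?A2 - 2) * of_bool (2 \<le> adj C b) \<le> nonadj A b" if b: "b \<in> B" for b
  proof (cases "2 \<le> adj C b")
    case True
    hence "card ?A2 + 1 \<le> nonadj A b" using nB2 b by blast
    thus ?thesis using True adj_le_3[of b] A3 A3_A2 by simp
  qed (use adj_le_B[OF b] in simp)
  hence "(\<Sum>b\<in>B - B1. adj C b + (card ?A2 - 2) * of_bool (2 \<le> adj C b)) \<le> (\<Sum>b\<in>B - B1. nonadj A b)"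
    by (intro sum_mono) auto
  moreover have "{b \<in> B - B1. 2 \<le> adj C b} = ?B2" using B2_sub by blast
  ultimately have "(\<Sum>b\<in>B - B1. adj C b) + (card ?A2 - 2) * card ?B2 \<le> (\<Sum>b\<in>B - B1. nonadj A b)"
    using card_filter_eq_sum[OF fin(4), of "\<lambda>b. 2 \<le> adj C b"] by (simp only: sum.distrib sum_distrib_left)
  hence AB2: "(card ?A2 - 2) * card ?B2 \<le> card ?A2 - 2"
    using SI e0 A3 A3_A2 by linarith
  have "?B2 \<noteq> {}"
  proof
    assume "?B2 = {}"
    hence "(\<Sum>b\<in>B. adj C b) \<le> (\<Sum>b\<in>B. 1)"
      by (intro sum_mono) (auto simp: not_le)
    thus False using excess_B sum_adj_le e0 by simp
  qed
  then obtain b0 where b0: "b0 \<in> ?B2" by blast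
  have nb: "nonadj A b + 2 \<le> card ?A2 + adj C b" if b: "b \<in> ?B2" for b
  proof -
    have bB: "b \<in> B - B1" using that B2_sub by blast
    have "(\<Sum>b\<in>B - B1 - {b}. adj C b) \<le> (\<Sum>b\<in>B - B1 - {b}. nonadj A b)"
      by (rule leB) blast
    thus ?thesis
      using SI e0 A3_A2 sum.remove[OF fin(4) bB, of "adj C"] sum.remove[OF fin(4) bB, of "nonadj A"]
      by linarith
  qed
  have b0_3: "adj C b0 = 3" using nb[OF b0] nB2[OF b0] adj_le_3[of b0] by linarith
  have "card {a \<in> A. 1 \<le> adj C a} \<le> nonadj A b0"
    using b0_3 not_H_of_adj[of b0] finite_ABC by (intro nonadj_ge) auto
  hence A_pos: "card {a \<in> A. 1 \<le> adj C a} \<le> card ?A2 + 1"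
    using nb[OF b0] b0_3 by linarith
  show False
  \<comment> \<open>In the first case \<open>A\<close> sends at most 3 + 2 * 2 = 7 edges to
    \<open>C\<close>; in the second, \<open>?B2\<close> has at most one element and \<open>B\<close>
    sends at most 3 + 2 = 5. By \<open>excess_8\<close> either side sends at least 8.\<close>
  proof (cases "card ?A2 = 2")
    case True
    hence "(\<Sum>a\<in>A. adj C a) \<le> 7"
      using sum_adj_le_card[OF finite_ABC(1)] A_pos by linarith
    thus False using excess_8 sum_adj_le e0 by linarith
  next
    case False
    hence "0 < card ?A2 - 2" using A3 A3_A2 by linarith
    hence B2: "card ?B2 \<le> 1" using AB2 by simp
    have B_pos: "card {b \<in> B. 1 \<le> adj C b} + 1 \<le> card B"
    proof -
      interpret M: excess_edge V E v y x u B A C z by (rule mirror3)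
      have "v \<notin> {b \<in> B. 1 \<le> adj C b}"
        using M.adj_u by simp
      hence "card {b \<in> B. 1 \<le> adj C b} < card B"
        using vB finite_ABC by (intro psubset_card_mono) blast+
      thus ?thesis by simp
    qed
    have "(\<Sum>b\<in>B. adj C b) \<le> card B + 1"
      using sum_adj_le_card[OF finite_ABC(2)] B2 B_pos by linarith
    hence eq: "miss A B \<le> (\<Sum>a\<in>A. adj C a)"
      using excess_B e0 by linarith
    obtain a0 where a0: "a0 \<in> A" "adj C a0 = 3"
      using A3 by (metis (mono_tags, lifting) DiffD1 card.empty empty_Collect_eq not_numeral_le_zero)
    have "(\<Sum>a\<in>A - {a0}. adj C a) \<le> (\<Sum>a\<in>A - {a0}. nonadj B a)"
      using adj_le_A by (intro sum_mono) auto
    hence "nonadj B a0 \<le> 3"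
      using eq a0(2) sum.remove[OF finite_ABC(1) a0(1), of "adj C"] sum.remove[OF finite_ABC(1) a0(1), of "nonadj B"]
      unfolding miss_def by linarith
    moreover have "card {b \<in> B. 1 \<le> adj C b} \<le> nonadj B a0"
      using a0 not_H_of_adj[of a0] finite_ABC by (intro nonadj_ge) auto
    ultimately have "(\<Sum>b\<in>B. adj C b) \<le> 5"
      using sum_adj_le_card[OF finite_ABC(2)] B2 by linarith
    thus False using excess_8 sum_adj_le e0 by linarith
  qed
qed

end

section \<open>A third vertex adjacent to an end of the edge\<close>

context excess_edge
begin

lemma path_to_v3:
  "a \<in> A \<Longrightarrow> \<exists>s t. E a s \<and> E s t \<and> E t v \<and> (s \<in> B \<or> s = x \<or> s = z) \<and> (t \<in> B \<or> t = y \<or> t = z)"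
  using path_to_v[of a] C3 by blast

lemma path_to_u3:
  "b \<in> B \<Longrightarrow> \<exists>s t. E b s \<and> E s t \<and> E t u \<and> (s \<in> A \<or> s = y \<or> s = z) \<and> (t \<in> A \<or> t = x \<or> t = z)"
  using excess_edge.path_to_v3[OF mirror3] .

lemma not_E_A_v: "a \<in> A \<Longrightarrow> E t v \<Longrightarrow> \<not> E t a"
  using not_H_E2 E_sym unfolding A_eq by blast

lemma not_E_B_u: "b \<in> B \<Longrightarrow> E s u \<Longrightarrow> \<not> E s b"
  using not_H_E2 E_sym unfolding B_eq by blast

lemma adj_Ex: "E a x \<Longrightarrow> adj C a = of_bool (H a z)"
  using Exy H_not_E not_H_E2[of a x y] by (auto simp: adj_C)

lemma adj_Ey: "E b y \<Longrightarrow> adj C b = of_bool (H b z)"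
  using E_sym[OF Exy] H_not_E not_H_E2[of b y x] by (auto simp: adj_C)

text \<open>If \<open>z\<close> is also adjacent to \<open>y\<close>, it plays the same role as
  \<open>x\<close> and \<open>no_split\<close> applies. Otherwise \<open>y x u z\<close> is a
  shortest path, so \<open>e = 1\<close>, and the remaining counts contradict
  \<open>excess_A\<close> or \<open>excess_B\<close>.\<close>

lemma adjacent_to_u:
  assumes Ezu: "E z u"
  shows False
proof -
  have zB: "\<not> E b z" if "b \<in> B" for b
    using not_E_B_u[OF that Ezu] E_sym by blast
  have Ezv: "\<not> E z v" using not_H_E2[OF E_sym[OF Ezu]] Huv by blast
  have Hxz: "\<not> H x z" using not_H_E2[OF E_sym[OF Eux] E_sym[OF Ezu]] .
  have nbr_v: "E t y" if "t \<in> B" "E t v" for t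
    using path_to_u3[OF that(1)] not_E_A_v[OF _ that(2)] zB[OF that(1)] by blast
  define A1 where "A1 = {a \<in> A. E a x \<or> E a z}"
  define B1 where "B1 = {b \<in> B. E b y}"
  have sub: "A1 \<subseteq> A" "B1 \<subseteq> B" "u \<in> A1" "v \<in> B1"
    unfolding A1_def B1_def using uA vB Eux E_sym[OF Eyv] by auto
  have fin: "finite A1" "finite B1" using sub finite_ABC finite_subset by blast+
  have cross: "\<exists>s t. E a s \<and> E s t \<and> E t v \<and> s \<in> B \<and> (t \<in> B \<or> t = y)"
    if a: "a \<in> A" "\<not> E a x" "\<not> (E a z \<and> E z y)" for a
  proof -
    obtain s t where "E a s" "E s t" "E t v" "s \<in> B \<or> s = x \<or> s = z" "t \<in> B \<or> t = y \<or> t = z"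
      using path_to_v3[OF a(1)] by blast
    thus ?thesis using a zB Ezv E_sym by blast
  qed
  have mA: "\<exists>b\<in>B1. \<not> H a b" if a: "a \<in> A" "\<not> E a x" "\<not> (E a z \<and> E z y)" for a
    using cross[OF a] nbr_v H_not_E not_H_E2 unfolding B1_def by blast
  have mB: "\<exists>a\<in>A1. \<not> H b a" if b: "b \<in> B" "\<not> E b y" for b
  proof -
    obtain s t where st: "E b s" "E s t" "E t u" "s \<in> A" "t \<in> A \<or> t = x \<or> t = z"
      using path_to_u3[OF b(1)] b zB by blast
    have "E t x \<or> E t z" if "t \<in> A"
      using cross[OF that] not_E_B_u[OF _ st(3)] by blast
    thus ?thesis unfolding A1_def using st H_not_E not_H_E2 by blast
  qed
  show False
  proof (cases "E z y")
    case True
    have Hyz: "\<not> H y z" using H_not_E E_sym True by blast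
    have near: "\<not> H p y \<and> (\<not> H p x \<or> \<not> H p z)" if "E p x \<or> E p z" for p
      using that Exy True H_not_E not_H_E2 by blast
    have kA1: "adj C a \<le> 1" if "a \<in> A1" for a
      using near[of a] that unfolding A1_def by (auto simp: adj_C)
    have kB1: "adj C b = 0" if "b \<in> B1" for b
      using adj_Ey[of b] that not_H_E2[of b y z] E_sym[OF True] unfolding B1_def by auto
    show False
    proof (rule no_split[OF sub(1,2,3)])
      show "(\<Sum>b\<in>B1. adj C b) \<le> miss A1 B1" using kB1 by simp
      show "\<exists>b\<in>B1. \<not> H a b" if "a \<in> A - A1" for a
        using mA[of a] that unfolding A1_def by blast
      show "\<exists>a\<in>A1. \<not> H b a" if "b \<in> B - B1" for b
        using mB[of b] that unfolding B1_def by blast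
    qed (use kA1 kB1 Hxz Hyz in auto)
  next
    case False
    have zy': "\<not> E y z" using False E_sym by blast
    \<comment> \<open>Otherwise \<open>z x y v\<close> is a walk of length three; since
      \<open>z\<close> is not in \<open>A\<close>, there would be a walk \<open>z t v\<close>, and
      no vertex can serve as \<open>t\<close>.\<close>
    have zx': "\<not> E z x"
    proof
      assume "E z x"
      moreover have "\<not> H z v" using z_notin unfolding A_eq by blast
      ultimately obtain t where t: "E z t" "E t v"
        unfolding H_def using Exy Eyv Ezv vB z_notin by blast
      have "t \<in> V" using E_in_V t by blast
      thus False
        using V_cases[of t] not_E_A_v[of t] t zB E_sym False not_Exv E_irrefl Ezv uA Huv H_not_E
        unfolding A_eq by blast
    qed
    have "\<not> E c z \<or> \<not> E y c" for c
    proof (rule ccontr)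
      assume "\<not> (\<not> E c z \<or> \<not> E y c)"
      hence c: "E c z" "E y c" by auto
      have "c \<in> V" using E_in_V c by blast
      thus False using V_cases[of c] c yA zB zx' zy' E_irrefl E_sym by blast
    qed
    hence Hyz: "H y z"
      unfolding H_def using zy zy' E_sym[OF Exy] E_sym[OF Eux] E_sym[OF Ezu] by blast
    have k2: "adj C p \<le> 2" for p by (rule adj_le_2) (simp add: Hyz)
    show False
    proof (cases "\<exists>a\<in>A. E a x \<and> H a z")
      case True
      then obtain a1 where a1: "a1 \<in> A" "E a1 x" "H a1 z" by blast
      define Ax where "Ax = {a \<in> A. E a x}"
      have Ax: "Ax \<subseteq> A" "u \<in> Ax" "finite Ax" unfolding Ax_def using uA Eux finite_ABC by auto
      \<comment> \<open>By triangle-freeness at \<open>z\<close>, the vertex \<open>a1\<close>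
        misses each \<open>b\<close> with \<open>H b z\<close>. Then \<open>split_A\<close> asks for
        two units, but only \<open>e = 1\<close> is available.\<close>
      have "(\<Sum>b\<in>B1. adj C b) \<le> (\<Sum>b\<in>B1. nonadj Ax b)"
      proof (rule sum_mono)
        fix b assume b: "b \<in> B1"
        show "adj C b \<le> nonadj Ax b"
        proof (cases "H b z")
          case True
          hence "\<not> H b a1" using triangle_free[OF True H_sym[OF a1(3)]] by blast
          hence "1 \<le> nonadj Ax b" using a1 Ax by (intro nonadj_pos) (auto simp: Ax_def)
          thus ?thesis using adj_Ey[of b] b by (simp add: B1_def True)
        qed (use adj_Ey[of b] b in \<open>simp add: B1_def\<close>)
      qed
      hence good: "(\<Sum>b\<in>B1. adj C b) \<le> miss Ax B1"
        using miss_commute[OF Ax(3) fin(2)] by (simp add: miss_def)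
      have "(\<Sum>b\<in>B - B1. nonadj A b) + 2 \<le> card {a \<in> A - Ax. adj C a = 3} + (\<Sum>b\<in>B - B1. adj C b) + e"
      proof (rule split_A[OF Ax(1) sub(2) Ax(2) _ good])
        show "adj C a \<le> 1" if "a \<in> Ax" for a using that adj_Ex[of a] by (simp add: Ax_def)
        show "\<exists>b\<in>B1. \<not> H a b" if "a \<in> A - Ax" for a using that mA[of a] False by (auto simp: Ax_def)
      qed
      moreover have "adj C a \<noteq> 3" for a using k2[of a] by linarith
      hence "card {a \<in> A - Ax. adj C a = 3} = 0" by simp
      moreover have "(\<Sum>b\<in>B - B1. adj C b) \<le> (\<Sum>b\<in>B - B1. nonadj A b)"
        using adj_le_B by (intro sum_mono) auto
      moreover have "e = 1" using Hxz Hyz by simp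
      ultimately show False by linarith
    next
      case noZ: False
      \<comment> \<open>Within \<open>A1\<close> only the vertices of \<open>L\<close> have
        \<open>H\<close>-neighbours in \<open>C\<close>, and those of \<open>D\<close> have two. A
        vertex of \<open>D\<close> finds an extra missing partner outside \<open>B1\<close>.\<close>
      define L where "L = {a \<in> A. \<not> E a x \<and> E a z}"
      define D where "D = {a \<in> L. H a x \<and> H a y}"
      have L: "L \<subseteq> A1" "finite L" "D \<subseteq> L" "finite D"
        unfolding L_def D_def A1_def using finite_ABC by auto
      have "\<exists>s\<in>B - B1. \<not> H a s \<and> \<not> H s y \<and> \<not> H s z" if a: "a \<in> D" for a
      proof -
        have a': "a \<in> A" "\<not> E a x" "E a z" "H a y" using a unfolding D_def L_def by auto
        obtain s t where st: "E a s" "E s t" "E t v" "s \<in> B" "t \<in> B \<or> t = y"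
          using cross[OF a'(1,2)] False by blast
        have "\<not> E s y" using st(1) a'(4) not_H_E2 by blast
        hence "t \<in> B" using st by blast
        hence "E t y" using nbr_v st by blast
        hence "\<not> H s y" using st not_H_E2 by blast
        moreover have "\<not> H s z" using st a' not_H_E2 E_sym by blast
        moreover have "\<not> H a s" using st H_not_E by blast
        ultimately show ?thesis using \<open>\<not> E s y\<close> st(4) unfolding B1_def by blast
      qed
      then obtain s where s: "\<And>a. a \<in> D \<Longrightarrow> s a \<in> B - B1 \<and> \<not> H a (s a) \<and> \<not> H (s a) y \<and> \<not> H (s a) z"
        by metis
      \<comment> \<open>If \<open>b\<close> is hit by \<open>s\<close>, it has at most one edge to
        \<open>C\<close> and misses the whole fibre; otherwise it has at most two edges and a
        missing pair by \<open>mB\<close>.\<close>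
      have "card {a \<in> D. s a = b} + adj C b \<le> nonadj A1 b + 1" if b: "b \<in> B - B1" for b
      proof (cases "{a \<in> D. s a = b} = {}")
        case True
        have "1 \<le> nonadj A1 b" using mB[of b] b nonadj_pos[OF fin(1)] unfolding B1_def by blast
        thus ?thesis unfolding True using k2[of b] by simp
      next
        case False
        hence "adj C b \<le> 1" using s by (auto simp: adj_C)
        moreover have "card {a \<in> D. s a = b} \<le> nonadj A1 b"
          using fin L s H_sym by (intro nonadj_ge) blast+
        ultimately show ?thesis by simp
      qed
      hence "(\<Sum>b\<in>B - B1. card {a \<in> D. s a = b} + adj C b) \<le> (\<Sum>b\<in>B - B1. nonadj A1 b + 1)"
        by (rule sum_mono)
      moreover have "(\<Sum>b\<in>B - B1. card {a \<in> D. s a = b}) = card D"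
        using sum.group[of D "B - B1" s "\<lambda>_. 1::nat"] L finite_ABC s by auto
      ultimately have 1: "card D + (\<Sum>b\<in>B - B1. adj C b) \<le> miss (B - B1) A1 + card (B - B1)"
        unfolding miss_def sum.distrib by simp
      have "adj C a \<le> of_bool (a \<in> L) + of_bool (a \<in> D)" if a: "a \<in> A1" for a
      proof (cases "E a x")
        case True
        thus ?thesis using adj_Ex[OF True] noZ a unfolding A1_def by auto
      next
        case False
        hence "a \<in> L" "\<not> H a z" using a H_not_E unfolding A1_def L_def by blast+
        thus ?thesis by (auto simp: adj_C D_def)
      qed
      hence "(\<Sum>a\<in>A1. adj C a) \<le> (\<Sum>a\<in>A1. of_bool (a \<in> L) + of_bool (a \<in> D))"
        by (rule sum_mono)
      also have "\<dots> = card L + card D"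
        using L fin by (simp add: sum.distrib Int_absorb1 Int_absorb2 subset_trans[OF L(3,1)])
      finally have 2: "(\<Sum>a\<in>A1. adj C a) \<le> card L + card D" .
      have "card L \<le> miss L B1"
        using mA False fin unfolding L_def by (intro miss_ge_card) auto
      also have "\<dots> \<le> miss A1 B1" by (rule miss_mono[OF fin L(1) order_refl])
      finally have 3: "card L \<le> miss A1 B1" .
      have 4: "(\<Sum>b\<in>B1. adj C b) + 1 \<le> card B1"
        using excess_edge.sum_adj_with_u[OF mirror3 sub(2,4)] adj_Ey unfolding B1_def by auto
      have 5: "miss A B = miss A1 B1 + miss (B - B1) A1 + miss (A - A1) B"
      proof -
        have "miss A1 B = miss B1 A1 + miss (B - B1) A1"
          using miss_commute[OF fin(1) finite_ABC(2)] miss_split[OF finite_ABC(2) sub(2)] by simp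
        thus ?thesis
          using miss_split[OF finite_ABC(1) sub(1), of B] miss_commute[OF fin] by simp
      qed
      have 6: "(\<Sum>a\<in>A - A1. adj C a) \<le> miss (A - A1) B"
        unfolding miss_def using adj_le_A by (intro sum_mono) auto
      have 7: "(\<Sum>a\<in>A. adj C a) = (\<Sum>a\<in>A - A1. adj C a) + (\<Sum>a\<in>A1. adj C a)"
        "(\<Sum>b\<in>B. adj C b) = (\<Sum>b\<in>B - B1. adj C b) + (\<Sum>b\<in>B1. adj C b)"
        using sub finite_ABC by (simp_all add: sum.subset_diff)
      have 8: "card B = card (B - B1) + card B1"
        using card_Diff_subset[OF fin(2) sub(2)] card_mono[OF finite_ABC(2) sub(2)] by simp
      have "e = 1" using Hxz Hyz by simp
      thus False using excess_B 1 2 3 4 5 6 7 8 by linarith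
    qed
  qed
qed

end

section \<open>A third vertex apart from the edge\<close>

text \<open>Generic in its arguments so that mirroring exchanges the instances \<open>A1\<close> and
  \<open>B1\<close> below. The second alternative is what makes \<open>B1\<close> contain every
  neighbour of \<open>v\<close> in \<open>B\<close>.\<close>

definition (in dist_three) inner_part :: "'a set \<Rightarrow> 'a \<Rightarrow> 'a \<Rightarrow> 'a \<Rightarrow> 'a set" where
  "inner_part S p q r = {s \<in> S. E s p \<or> E s q \<and> E s r}"

locale apart_edge = excess_edge +
  assumes not_Ezu: "\<not> E z u" and not_Ezv: "\<not> E z v"
begin

lemma mirror4: "apart_edge V E v y x u B A C z"
  using mirror3 not_Ezu not_Ezv by (simp add: apart_edge_def apart_edge_axioms_def)

abbreviation A1 where "A1 \<equiv> inner_part A x z u"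
abbreviation B1 where "B1 \<equiv> inner_part B y z v"

lemma A1_sub: "A1 \<subseteq> A" "u \<in> A1" "finite A1"
  unfolding inner_part_def using uA Eux finite_ABC by auto

lemma B1_sub: "B1 \<subseteq> B" "v \<in> B1" "finite B1"
  unfolding inner_part_def using vB E_sym[OF Eyv] finite_ABC by auto

lemma path_to_v4:
  "a \<in> A \<Longrightarrow> \<exists>s t. E a s \<and> E s t \<and> E t v \<and> (s \<in> B \<or> s = x \<or> s = z) \<and> (t \<in> B \<or> t = y)"
  using path_to_v3[of a] not_Ezv by blast

lemma path_to_u4:
  "b \<in> B \<Longrightarrow> \<exists>s t. E b s \<and> E s t \<and> E t u \<and> (s \<in> A \<or> s = y \<or> s = z) \<and> (t \<in> A \<or> t = x)"
  using path_to_u3[of b] not_Ezu by blast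

text \<open>A shortest path from \<open>t\<close> to \<open>u\<close> starts towards
  \<open>y\<close>, \<open>z\<close> or \<open>A\<close>; a neighbour in \<open>A\<close> would be
  within two steps of \<open>v\<close>.\<close>

lemma nbr_v: "t \<in> B \<Longrightarrow> E t v \<Longrightarrow> t \<in> B1"
  using path_to_u4[of t] not_E_A_v unfolding inner_part_def by blast

lemma nonadj_of_Hy:
  assumes "a \<in> A" "H a y"
  shows "\<exists>t\<in>B1. \<not> H a t"
proof -
  obtain s t where st: "E a s" "E s t" "E t v" "t \<in> B \<or> t = y"
    using path_to_v4[OF assms(1)] by blast
  hence "t \<in> B" using assms(2) not_H_E2 by blast
  thus ?thesis using nbr_v st not_H_E2 by blast
qed

text \<open>On a shortest path \<open>a s t v\<close>, a vertex \<open>t\<close> of \<open>B\<close>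
  is the witness by \<open>nbr_v\<close>; if \<open>t = y\<close>, then \<open>s\<close> lies in
  \<open>B\<close> and is adjacent to \<open>y\<close>.\<close>

lemma nonadj_of_far:
  assumes "a \<in> A" "\<not> E a x" "\<not> (E a z \<and> E z y)"
  shows "\<exists>t\<in>B1. \<not> H a t"
proof -
  obtain s t where st: "E a s" "E s t" "E t v" "s \<in> B \<or> s = z" "t \<in> B \<or> t = y"
    using path_to_v4[OF assms(1)] assms(2) by blast
  show ?thesis
  proof (cases "t \<in> B")
    case True
    thus ?thesis using nbr_v st not_H_E2 by blast
  next
    case False
    hence "s \<in> B1" using st assms(3) unfolding inner_part_def by blast
    thus ?thesis using st H_not_E by blast
  qed
qed

lemma nonadj_of_adj:
  assumes "a \<in> A - A1" "2 \<le> adj C a"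
  shows "\<exists>t\<in>B1. \<not> H a t"
proof (cases "H a y")
  case True
  thus ?thesis using nonadj_of_Hy assms by blast
next
  case False
  hence "H a z" using assms(2) by (auto simp: adj_C of_bool_def split: if_splits)
  thus ?thesis using nonadj_of_far[of a] H_not_E assms(1) unfolding inner_part_def by blast
qed

lemma adj_Ezu:
  assumes "E a z" "E a u" shows "adj C a = of_bool (H a y)"
proof -
  have "\<not> H a z" "\<not> H a x" using assms H_not_E not_H_E2 Eux by blast+
  thus ?thesis by (simp add: adj_C)
qed

lemma adj_A1: "a \<in> A1 \<Longrightarrow> adj C a \<le> 1"
  using adj_Ex[of a] adj_Ezu[of a] unfolding inner_part_def by auto

lemmas mirrored =
  apart_edge.nonadj_of_Hy[OF mirror4]
  apart_edge.nonadj_of_far[OF mirror4]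
  apart_edge.nonadj_of_adj[OF mirror4]
  apart_edge.adj_A1[OF mirror4]
  apart_edge.adj_Ezu[OF mirror4]

end

context apart_edge
begin

text \<open>A neighbour of \<open>y\<close> can be \<open>H\<close>-adjacent in \<open>C\<close>
  only to \<open>z\<close>, and then \<open>good\<close> supplies a vertex of \<open>A1\<close>
  sharing that neighbour. A common neighbour of \<open>z\<close> and \<open>v\<close> can be
  \<open>H\<close>-adjacent only to \<open>x\<close>, and \<open>nonadj_of_Hy\<close> applies
  mirrored.\<close>

lemma adj_le_nonadj_B1:
  assumes good: "(\<exists>a\<in>A. E a x \<and> H a z) \<or> (\<forall>b\<in>B. E b y \<longrightarrow> \<not> H b z)"
    and b: "b \<in> B1"
  shows "adj C b \<le> nonadj A1 b"
proof (cases "E b y")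
  case True
  show ?thesis
  proof (cases "H b z")
    case Hbz: True
    then obtain a where a: "a \<in> A" "E a x" "H a z"
      using good b True unfolding inner_part_def by blast
    have "\<not> H b a" using triangle_free[OF Hbz H_sym[OF a(3)]] .
    moreover have "a \<in> A1" using a unfolding inner_part_def by blast
    ultimately show ?thesis using nonadj_pos[OF A1_sub(3)] adj_Ey[OF True] Hbz by simp
  qed (use adj_Ey[OF True] in simp)
next
  case False
  hence bz: "E b z" "E b v" "b \<in> B" using b unfolding inner_part_def by auto
  show ?thesis
  proof (cases "H b x")
    case True
    thus ?thesis using mirrored(1)[OF bz(3) True] nonadj_pos[OF A1_sub(3)] mirrored(5)[OF bz(1,2)] by auto
  qed (use mirrored(5)[OF bz(1,2)] in simp)
qed

text \<open>If \<open>z\<close> is joined in \<open>H\<close> to both \<open>x\<close> and \<open>y\<close>, all estimates are tight up to the last unit;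
  this forces a seven-cycle \<open>u x y v t z w\<close> in the graph.\<close>

lemma no_double:
  assumes good: "(\<exists>a\<in>A. E a x \<and> H a z) \<or> (\<forall>b\<in>B. E b y \<longrightarrow> \<not> H b z)"
    and Hxz: "H x z" and Hyz: "H y z"
  shows False
proof -
  have nE: "\<not> E z x" "\<not> E z y" "\<not> E x z" "\<not> E y z"
    using Hxz Hyz H_not_E E_sym by blast+
  have near_xz: "\<not> (E p x \<and> E p z)" and near_yz: "\<not> (E p y \<and> E p z)" for p
    using not_H_E2[of x p z] not_H_E2[of y p z] Hxz Hyz E_sym by blast+
  have k2: "adj C p \<le> 2" for p by (rule adj_le_2) (simp add: Hxz)
  have Hz: "\<not> H p x \<and> \<not> H p y" if "H p z" for p
    using that triangle_free[of p x z] triangle_free[of p y z] Hxz Hyz by blast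
  have fin: "finite (A - A1)" "finite (B - B1)" "finite (A1 - {u})"
    using finite_ABC A1_sub by auto
  define As where "As = A - A1"
  define Bs where "Bs = B - B1"
  have finA: "finite As" and finB: "finite Bs" unfolding As_def Bs_def using fin by auto
  have As1: "1 \<le> nonadj B1 a" if "a \<in> As" for a
    using nonadj_of_far[of a] that nE nonadj_pos[OF B1_sub(3)] unfolding As_def inner_part_def by blast
  have Bs1: "\<exists>a\<in>A1. \<not> H b a" if "b \<in> Bs" for b
    using mirrored(2)[of b] that nE unfolding Bs_def inner_part_def by blast

  have le1: "adj C a \<le> 1" if "a \<in> A1 - {u}" for a using adj_A1 that by blast
  have le2: "adj C a \<le> 1 + nonadj B1 a" if "a \<in> As" for a
    using As1[OF that] k2[of a] by linarith
  have le3: "adj C b \<le> nonadj A1 b" if "b \<in> B1" for b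
    using adj_le_nonadj_B1[OF good that] .
  have le4: "adj C b \<le> nonadj A b" if "b \<in> Bs" for b
    using adj_le_B that unfolding Bs_def by blast
  have s1: "(\<Sum>a\<in>A1 - {u}. adj C a) \<le> (\<Sum>a\<in>A1 - {u}. 1)" by (intro sum_mono le1)
  have s2: "(\<Sum>a\<in>As. adj C a) \<le> (\<Sum>a\<in>As. 1 + nonadj B1 a)" by (intro sum_mono le2)
  have s3: "(\<Sum>b\<in>B1. adj C b) \<le> (\<Sum>b\<in>B1. nonadj A1 b)" by (intro sum_mono le3)
  have s4: "(\<Sum>b\<in>Bs. adj C b) \<le> (\<Sum>b\<in>Bs. nonadj A b)" by (intro sum_mono le4)
  have sA: "(\<Sum>a\<in>A. adj C a) = (\<Sum>a\<in>As. adj C a) + (\<Sum>a\<in>A1 - {u}. adj C a)"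
    unfolding As_def using A1_sub finite_ABC adj_u
    by (simp add: sum.subset_diff[OF A1_sub(1)] sum.remove[OF A1_sub(3,2)])
  have sB: "(\<Sum>b\<in>B. adj C b) = (\<Sum>b\<in>Bs. adj C b) + (\<Sum>b\<in>B1. adj C b)"
    unfolding Bs_def using finite_ABC by (simp add: sum.subset_diff[OF B1_sub(1)])
  have cA: "card A = card As + (card (A1 - {u}) + 1)"
    unfolding As_def using card_Diff_subset[OF A1_sub(3,1)] card_mono[OF finite_ABC(1) A1_sub(1)]
      card_Suc_Diff1[OF A1_sub(3,2)] by simp
  have ms: "miss A B = (\<Sum>b\<in>B1. nonadj A1 b) + (\<Sum>a\<in>As. nonadj B1 a) + (\<Sum>b\<in>Bs. nonadj A b)"
    using miss_split3[OF A1_sub(1) B1_sub(1)] miss_commute[OF A1_sub(3) B1_sub(3)]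
    by (simp add: miss_def As_def Bs_def)
  have e2: "e = 2" using Hxz Hyz by simp
  have c1: "(\<Sum>a\<in>A1 - {u}. 1) = card (A1 - {u})" by simp
  have c2: "(\<Sum>a\<in>As. 1 + nonadj B1 a) = card As + (\<Sum>a\<in>As. nonadj B1 a)"
    unfolding sum.distrib by simp
  \<comment> \<open>The upper estimates, with \<open>e = 2\<close> and the unit saved at
    \<open>u\<close>, add up to exactly the lower bound of \<open>excess_A\<close>. So all four are
    equalities, and termwise so.\<close>
  note lin = s1 s2 s3 s4 sA sB cA ms e2 c1 c2 excess_A
  have q1: "(\<Sum>a\<in>A1 - {u}. adj C a) = (\<Sum>a\<in>A1 - {u}. 1)" using lin by linarith
  have q2: "(\<Sum>a\<in>As. adj C a) = (\<Sum>a\<in>As. 1 + nonadj B1 a)" using lin by linarith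
  have q3: "(\<Sum>b\<in>B1. adj C b) = (\<Sum>b\<in>B1. nonadj A1 b)" using lin by linarith
  have q4: "(\<Sum>b\<in>Bs. adj C b) = (\<Sum>b\<in>Bs. nonadj A b)" using lin by linarith
  have E1: "adj C a = 2" if "a \<in> As" for a
    using sum_mono_inv[OF q2 le2 that finA] As1[OF that] k2[of a] by linarith
  have E2: "nonadj A b = adj C b" if "b \<in> Bs" for b
    using sum_mono_inv[OF q4 le4 that finB] by simp
  have E3: "adj C a = 1" if "a \<in> A1" "a \<noteq> u" for a
    using sum_mono_inv[OF q1 le1 _ fin(3), of a] that by blast
  have E4: "nonadj A1 b = adj C b" if "b \<in> B1" for b
    using sum_mono_inv[OF q3 le3 that B1_sub(3)] by simp

  have wB: "\<not> E p b" if "E p u" "b \<in> B" for p b using not_E_B_u that by blast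
  \<comment> \<open>Here \<open>c\<close> lies in \<open>A1\<close>, is adjacent to \<open>x\<close>
    and not \<open>H\<close>-adjacent to \<open>z\<close>, so it has no \<open>H\<close>-neighbour
    in \<open>C\<close>; by \<open>E3\<close> it is \<open>u\<close>.\<close>
  obtain c w where cw: "E x c" "E c w" "E w z" using H_path[OF Hxz] by blast
  have "c \<in> V" using E_in_V cw by blast
  hence "c \<in> A"
    using V_cases[of c] cw xB E_sym E_irrefl nE near_yz[of w] by blast
  hence cA1: "c \<in> A1" "E c x" using cw E_sym unfolding inner_part_def by blast+
  moreover have "\<not> H c z" using cw not_H_E2 by blast
  ultimately have "c = u" using E3 adj_Ex by fastforce
  hence wu: "E w u" using cw E_sym by blast
  have wx: "\<not> E w x" using near_xz cw by blast
  have "w \<in> V" using E_in_V cw by blast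
  moreover have "w \<notin> B" using wu H_not_E unfolding B_eq by blast
  ultimately have wA: "w \<in> A"
    using V_cases[of w] cw wu nE not_Ezu not_Euy E_sym by blast
  have wA1: "w \<in> A1" using wA wu cw unfolding inner_part_def by blast
  have wnu: "w \<noteq> u" using wx Eux by blast
  have Hwy: "H w y"
    using E3[OF wA1 wnu] adj_Ezu[OF cw(3) wu] by (cases "H w y") simp_all
  obtain s t where st: "E w s" "E s t" "E t v" "s \<in> B \<or> s = x \<or> s = z" "t \<in> B \<or> t = y"
    using path_to_v4[OF wA] by blast
  have "s = z" using st wx wB[OF wu] by blast
  hence zt: "E z t" "t \<in> B" "E t v" using st nE by blast+
  have ty: "\<not> E t y" using near_yz zt E_sym by blast
  have tB1: "t \<in> B1" using nbr_v zt by blast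

  \<comment> \<open>\<open>t\<close> misses every neighbour of \<open>z\<close>, but by
    \<open>E4\<close> at most one vertex of \<open>A1\<close>.\<close>
  have LA: "a = w" if "a \<in> A" "E a z" "E a u" for a
  proof (rule ccontr)
    assume "a \<noteq> w"
    have "\<not> H t p" if "E p z" for p using zt that not_H_E2 E_sym by blast
    hence "card {a, w} \<le> nonadj A1 t"
      using that wA1 cw A1_sub by (intro nonadj_ge) (auto simp: inner_part_def)
    thus False using \<open>a \<noteq> w\<close> E4[OF tB1] mirrored(4)[OF tB1] by simp
  qed
  define Z1 where "Z1 = {a \<in> A. E a x \<and> H a z}"
  have Z1: "Z1 \<subseteq> A1" "finite Z1" "w \<notin> Z1" unfolding Z1_def using wx finite_ABC by (auto simp: inner_part_def)
  have A1_cases: "a = u \<or> a = w \<or> a \<in> Z1" if "a \<in> A1" for a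
  proof (cases "E a x")
    case True
    have "a \<in> A" using that unfolding inner_part_def by blast
    moreover have "a = u \<or> H a z"
      using E3[OF that] adj_Ex[OF True] by (cases "H a z") auto
    ultimately show ?thesis using True unfolding Z1_def by blast
  next
    case False
    thus ?thesis using LA that unfolding inner_part_def by blast
  qed
  have missZ: "card Z1 \<le> nonadj A1 b" "card Z1 \<le> nonadj A b" if "H b z" for b
    using Z1 A1_sub finite_ABC triangle_free[OF that H_sym] unfolding Z1_def
    by (auto intro!: nonadj_ge)
  have k_z: "adj C p = 1" if "H p z" for p using Hz[OF that] that by (simp add: adj_C)
  have As_xy: "H a x" "H a y" if "a \<in> As" for a
    using E1[OF that] Hz[of a] by (auto simp: adj_C of_bool_def split: if_splits)
  \<comment> \<open>\<open>b\<close> misses all of \<open>As\<close>, whose vertices are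
    \<open>H\<close>-adjacent to both \<open>x\<close> and \<open>y\<close>, and one vertex of
    \<open>A1\<close>; by \<open>E2\<close> its missing pairs are as many as its edges to
    \<open>C\<close>.\<close>
  have Bs_xy: "card As + 1 \<le> adj C b" if b: "b \<in> Bs" "H b x \<or> H b y" for b
  proof -
    obtain a where a: "a \<in> A1" "\<not> H b a" using Bs1[OF b(1)] by blast
    have "\<not> H b p" if "p \<in> As" for p
      using b(2) triangle_free[OF _ H_sym[OF As_xy(1)[OF that]]] triangle_free[OF _ H_sym[OF As_xy(2)[OF that]]]
      by blast
    moreover have "insert a As \<subseteq> A" using a A1_sub unfolding As_def by blast
    ultimately have "card (insert a As) \<le> nonadj A b"
      using a finite_ABC by (intro nonadj_ge) blast+
    moreover have "a \<notin> As" using a unfolding As_def by blast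
    ultimately show ?thesis using finA E2[OF b(1)] by simp
  qed
  have sumA: "(\<Sum>a\<in>A. adj C a) \<le> card Z1 + 1 + 2 * card As"
  proof -
    have "A1 - {u} \<subseteq> insert w Z1" using A1_cases by blast
    hence "card (A1 - {u}) \<le> card Z1 + 1"
      using card_mono[of "insert w Z1" "A1 - {u}"] Z1 by simp
    moreover have "(\<Sum>a\<in>As. adj C a) = 2 * card As" using E1 by simp
    ultimately show ?thesis using sA s1 by simp
  qed
  show False
  proof (cases "card As \<le> 1")
    case False
    have no_xy: "\<not> H b x \<and> \<not> H b y" if "b \<in> Bs" for b
      using Bs_xy[OF that] False k2[of b] by linarith
    have kB: "adj C b \<le> 1" if "b \<in> B" for b
      using mirrored(4)[of b] no_xy[of b] that unfolding Bs_def by (cases "b \<in> B1") (auto simp: adj_C)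
    have "(\<Sum>b\<in>B. adj C b) + 1 \<le> card B"
      by (rule excess_edge.sum_adj_with_u[OF mirror3 order_refl vB kB])
    hence "(\<Sum>a\<in>A. nonadj B a) \<le> (\<Sum>a\<in>A. adj C a)" using excess_B e2 unfolding miss_def by linarith
    moreover have "(\<Sum>a\<in>A. adj C a) \<le> (\<Sum>a\<in>A. nonadj B a)" by (intro sum_mono adj_le_A)
    ultimately have "(\<Sum>a\<in>A. adj C a) = (\<Sum>a\<in>A. nonadj B a)" by simp
    hence tight: "nonadj B a = adj C a" if "a \<in> A" for a
      using sum_mono_inv[of "adj C" A "nonadj B", OF _ adj_le_A that finite_ABC(1)] by simp
    have only_t: "b = t" if "b \<in> B" "\<not> H w b" for b
    proof (rule ccontr)
      assume "b \<noteq> t"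
      moreover have "\<not> H w t" using zt cw not_H_E2 by blast
      ultimately have "card {b, t} \<le> nonadj B w" using that zt finite_ABC by (intro nonadj_ge) auto
      thus False using \<open>b \<noteq> t\<close> tight[OF wA] adj_A1[OF wA1] by simp
    qed
    let ?ZB = "{b \<in> B. H b z}"
    have kb: "adj C b \<le> of_bool (b = t) + of_bool (H b z)" if "b \<in> B" for b
    proof (cases "b \<in> B1 \<and> \<not> E b y")
      case True
      hence bz: "E b z" "E b v" unfolding inner_part_def by auto
      hence "\<not> H w b" using cw not_H_E2 E_sym by blast
      thus ?thesis using only_t[OF that] mirrored(4)[of b] True by simp
    next
      case False
      thus ?thesis using adj_Ey[of b] no_xy[of b] that unfolding Bs_def by (auto simp: adj_C)
    qed
    have "(\<Sum>b\<in>B. adj C b) \<le> (\<Sum>b\<in>B. of_bool (b = t) + of_bool (H b z))"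
      using kb by (rule sum_mono)
    also have "\<dots> = card {b \<in> B. b = t} + card ?ZB"
      unfolding card_filter_eq_sum[OF finite_ABC(2)] sum.distrib ..
    also have "{b \<in> B. b = t} = {t}" using zt by blast
    \<comment> \<open>\<open>excess_8\<close> with \<open>e = 2\<close> requires six edges from
      \<open>B\<close> to \<open>C\<close>, and at most one of them, at \<open>t\<close>, avoids
      \<open>z\<close>.\<close>
    finally have ZB: "5 \<le> card ?ZB" using excess_8 sum_adj_le e2 by simp
    have Z1_empty: "Z1 = {}"
    proof (rule ccontr)
      assume "Z1 \<noteq> {}"
      then obtain a where a: "a \<in> A" "H a z" unfolding Z1_def by blast
      have "card ?ZB \<le> nonadj B a"
        using triangle_free[OF a(2) H_sym] finite_ABC by (intro nonadj_ge) auto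
      thus False using ZB tight[OF a(1)] k2[of a] by linarith
    qed
    have "b \<notin> Bs" for b
    proof
      assume b: "b \<in> Bs"
      obtain a where a: "a \<in> A1" "\<not> H b a" using Bs1[OF b] by blast
      have "b \<in> B" "b \<noteq> t" using b tB1 unfolding Bs_def by auto
      hence "H w b" "H u b" using only_t H_sym unfolding B_eq by blast+
      thus False using a A1_cases Z1_empty H_sym by blast
    qed
    hence "E b y" if "b \<in> B" "H b z" for b
      using that H_not_E unfolding Bs_def inner_part_def by blast
    moreover have "\<not> (\<exists>a\<in>A. E a x \<and> H a z)" using Z1_empty unfolding Z1_def by blast
    ultimately have "?ZB = {}" using good by blast
    thus False using ZB by (metis card.empty not_numeral_le_zero)
  next
    case True
    have Z1_2: "2 \<le> card Z1"
      using True sumA excess_8 sum_adj_le e2 by linarith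
    have noZ: "\<not> H b z" if "b \<in> B" for b
    proof
      assume z: "H b z"
      show False
      proof (cases "b \<in> B1")
        case True
        thus False using E4 missZ(1)[OF z] k_z[OF z] Z1_2 by fastforce
      next
        case False
        hence "b \<in> Bs" using that unfolding Bs_def by blast
        thus False using E2 missZ(2)[OF z] k_z[OF z] Z1_2 by fastforce
      qed
    qed
    obtain z1 where z1: "z1 \<in> Z1" using Z1_2 by fastforce
    have z1': "z1 \<in> A" "E z1 x" "H z1 z" "z1 \<in> A1" "z1 \<noteq> w" using z1 Z1 unfolding Z1_def by blast+
    \<comment> \<open>Tightness allows \<open>b\<close> at most two missing partners in
      \<open>A\<close>. Once \<open>H b y\<close> is known, \<open>w\<close> is one besides
      \<open>z1\<close>, so there are no others.\<close>
    have claim: "H b x \<and> H b y \<and> (\<forall>a\<in>A. \<not> H b a \<longrightarrow> a = w \<or> a = z1) \<and> \<not> E b y"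
      if b: "b \<in> B" "\<not> H b z1" for b
    proof -
      have bBs: "b \<in> Bs"
      proof (rule ccontr)
        assume "b \<notin> Bs"
        hence bB1: "b \<in> B1" using b unfolding Bs_def by blast
        have "1 \<le> nonadj A1 b" using nonadj_pos[OF A1_sub(3) z1'(4) b(2)] .
        hence "\<not> E b y" using E4[OF bB1] adj_Ey[of b] noZ[OF b(1)] by auto
        hence "E b z" using bB1 unfolding inner_part_def by blast
        hence "\<not> H b w" using cw not_H_E2 E_sym by blast
        hence "card {w, z1} \<le> nonadj A1 b"
          using b wA1 z1' A1_sub by (intro nonadj_ge) auto
        thus False using z1'(5) E4[OF bB1] mirrored(4)[OF bB1] by simp
      qed
      have bE: "\<not> E b y" using bBs unfolding Bs_def inner_part_def by blast
      have Hby: "H b y"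
      proof (rule ccontr)
        assume n: "\<not> H b y"
        have "1 \<le> nonadj A b" using nonadj_pos[OF finite_ABC(1) z1'(1) b(2)] .
        hence bx: "H b x" using E2[OF bBs] n noZ[OF b(1)] by (auto simp: adj_C of_bool_def split: if_splits)
        have "nonadj A b = 1" using E2[OF bBs] n bx noZ[OF b(1)] by (simp add: adj_C)
        have only: "a = z1" if "a \<in> A" "\<not> H b a" for a
        proof (rule ccontr)
          assume "a \<noteq> z1"
          have "card {a, z1} \<le> nonadj A b" using that b z1' finite_ABC by (intro nonadj_ge) auto
          thus False using \<open>a \<noteq> z1\<close> \<open>nonadj A b = 1\<close> by simp
        qed
        obtain p q where pq: "E b p" "E p q" "E q u" "p \<in> A \<or> p = z" "q \<in> A \<or> q = x"
          using path_to_u4[OF b(1)] bE by blast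
        show False
        proof (cases "p \<in> A")
          case True
          hence "p = z1" using only pq H_not_E by blast
          thus False using pq z1' bx not_H_E2 by blast
        next
          case False
          hence "p = z" "q \<in> A" using pq nE by blast+
          hence "q = w" using LA pq E_sym by blast
          moreover have "\<not> H b q" using pq not_H_E2 by blast
          ultimately show False using only wA z1' by blast
        qed
      qed
      have nw: "\<not> H b w" using triangle_free[OF Hby H_sym[OF Hwy]] .
      have 2: "nonadj A b \<le> 2" using E2[OF bBs] k2[of b] by simp
      have only: "a = w \<or> a = z1" if "a \<in> A" "\<not> H b a" for a
      proof (rule ccontr)
        assume n: "\<not> (a = w \<or> a = z1)"
        have "card {a, w, z1} \<le> nonadj A b" using that b z1' nw wA finite_ABC by (intro nonadj_ge) auto
        thus False using n z1'(5) 2 by simp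
      qed
      have "card {w, z1} \<le> nonadj A b" using b z1' nw wA finite_ABC by (intro nonadj_ge) auto
      hence "2 \<le> adj C b" using z1'(5) E2[OF bBs] by simp
      hence "H b x" using noZ[OF b(1)] by (auto simp: adj_C of_bool_def split: if_splits)
      thus ?thesis using Hby only bE by blast
    qed
    have "1 \<le> nonadj B z1" using adj_le_A[OF z1'(1)] k_z[OF z1'(3)] by simp
    then obtain b0 where b0: "b0 \<in> B" "\<not> H b0 z1"
      unfolding nonadj_def using H_sym by (metis (mono_tags, lifting) card.empty empty_Collect_eq not_one_le_zero)
    note cl = claim[OF b0]
    \<comment> \<open>A shortest path from \<open>b0\<close> to \<open>x\<close> must enter
      \<open>x\<close> through \<open>z1\<close>, by \<open>claim\<close>; then no vertex is
      possible for \<open>c\<close>.\<close>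
    obtain c c' where cc: "E b0 c" "E c c'" "E c' x" using cl H_path by blast
    have "c' \<in> V" "c \<in> V" using E_in_V cc by blast+
    hence "c' \<in> A"
      using V_cases[of c'] cc xB E_irrefl nE cl not_H_E2[of b0 c y] by blast
    hence "c' = z1" using cl cc not_H_E2 wx by blast
    hence cz1: "E c z1" using cc by blast
    consider "c \<in> A" | "c \<in> B" | "c = x" | "c = y" | "c = z" using V_cases[OF \<open>c \<in> V\<close>] by blast
    thus False
    proof cases
      case 1
      hence "c = w" using cl cc H_not_E cz1 E_irrefl by blast
      thus False using cc wB[OF wu b0(1)] E_sym by blast
    next
      case 2
      have "\<not> H c z1" using cz1 H_not_E by blast
      hence "H c x" using claim[OF 2] by blast
      thus False using cz1 z1' not_H_E2 by blast
    qed (use cc b0 xB cl cz1 z1' H_not_E E_sym in blast)+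
  qed
qed

text \<open>If \<open>good\<close> fails, its first alternative does, and this is the second
  alternative of the mirrored \<open>good\<close>. So it holds up to symmetry;
  \<open>no_double\<close> treats \<open>e = 2\<close> and \<open>no_split\<close> the rest.\<close>

lemma impossible: False
proof -
  have *: False if "apart_edge V E u x y v A B C z"
    and good: "(\<exists>a\<in>A. E a x \<and> H a z) \<or> (\<forall>b\<in>B. E b y \<longrightarrow> \<not> H b z)"
    for u x y v A B C
  proof -
    interpret P: apart_edge V E u x y v A B C z by fact
    have "(\<Sum>b\<in>P.B1. adj C b) \<le> (\<Sum>b\<in>P.B1. nonadj P.A1 b)"
      by (intro sum_mono P.adj_le_nonadj_B1[OF good])
    hence g: "(\<Sum>b\<in>P.B1. adj C b) \<le> miss P.A1 P.B1"
      using miss_commute[OF P.A1_sub(3) P.B1_sub(3)] by (simp add: miss_def)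
    show False
    proof (cases "H x z \<and> H y z")
      case True
      thus False using P.no_double[OF good] by blast
    next
      case False
      hence "P.e \<le> 1" by (auto simp: of_bool_def)
      thus False
        using P.no_split[OF P.A1_sub(1) P.B1_sub(1) P.A1_sub(2) P.adj_A1 P.mirrored(4) g P.nonadj_of_adj P.mirrored(3)]
        by blast
    qed
  qed
  show False
    using *[OF apart_edge_axioms] *[OF mirror4] by blast
qed

end

lemma (in excess_edge) impossible: False
proof -
  consider "E z u" | "E z v" | "\<not> E z u" "\<not> E z v" by blast
  thus False
  proof cases
    case 1
    thus False by (rule adjacent_to_u)
  next
    case 2
    thus False by (rule excess_edge.adjacent_to_u[OF mirror3])
  next
    case 3
    then interpret apart_edge V E u x y v A B C z by unfold_locales
    show False by (rule impossible)
  qed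
qed

section \<open>The bound on the degree sum\<close>

context triangle_free_dist_three
begin

lemma degree_sum_bound:
  assumes n: "18 \<le> card V"
  shows "2 * (\<Sum>p\<in>V. deg p) \<le> (card V - 2)\<^sup>2"
proof (rule ccontr)
  define n where "n = card V"
  assume "\<not> ?thesis"
  hence big: "int (n - 2) * int (n - 2) < 2 * int (\<Sum>p\<in>V. deg p)"
    unfolding n_def power2_eq_square by (metis linorder_not_le of_nat_less_iff of_nat_mult of_nat_numeral)
  have prod: "4 * (int p * int q) \<le> (int p + int q) * (int p + int q)" for p q :: nat
    using zero_le_square[of "int p - int q"] by (simp add: algebra_simps)
  have base: "\<exists>x y. base_edge V E u x y v {a. H a v} {b. H b u} (V - ({a. H a v} \<union> {b. H b u}))"
    if uv: "H u v" for u v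
  proof -
    obtain x y where xy: "E u x" "E x y" "E y v" using H_path[OF uv] by blast
    have "base_edge V E u x y v {a. H a v} {b. H b u} (V - ({a. H a v} \<union> {b. H b u}))"
      using xy uv by unfold_locales auto
    thus ?thesis by blast
  qed
  have le2: "deg u + deg v \<le> n - 2" if uv: "H u v" for u v
  proof -
    obtain x y where "base_edge V E u x y v {a. H a v} {b. H b u} (V - ({a. H a v} \<union> {b. H b u}))"
      using base[OF uv] by blast
    then interpret P: base_edge V E u x y v "{a. H a v}" "{b. H b u}" "V - ({a. H a v} \<union> {b. H b u})" .
    have "x \<noteq> y" using P.Exy E_irrefl by blast
    hence "2 = card {x, y}" by simp
    also have "\<dots> \<le> card (V - ({a. H a v} \<union> {b. H b u}))"
      using P.xyC P.finite_ABC by (intro card_mono) auto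
    finally show ?thesis using P.card_V P.deg_u P.deg_v unfolding n_def by linarith
  qed
  \<comment> \<open>A degree sum of \<open>n - 2\<close> leaves only \<open>x\<close> and
    \<open>y\<close> in \<open>C\<close>, so \<open>degree_sum_le2\<close> and the inequality of
    means contradict \<open>big\<close>.\<close>
  have le3: "deg u + deg v \<le> n - 3" if uv: "H u v" for u v
  proof (rule ccontr)
    assume neg: "\<not> ?thesis"
    obtain x y where b: "base_edge V E u x y v {a. H a v} {b. H b u} (V - ({a. H a v} \<union> {b. H b u}))"
      using base[OF uv] by blast
    interpret P: base_edge V E u x y v "{a. H a v}" "{b. H b u}" "V - ({a. H a v} \<union> {b. H b u})" by (rule b)
    let ?C = "V - ({a. H a v} \<union> {b. H b u})"
    have "x \<noteq> y" using P.Exy E_irrefl by blast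
    moreover have "card ?C \<le> 2"
      using neg le2[OF uv] P.card_V P.deg_u P.deg_v n unfolding n_def by linarith
    moreover have "{x, y} \<subseteq> ?C" using P.xyC by blast
    ultimately have "?C = {x, y}"
      using card_seteq[OF P.finite_ABC(3), of "{x, y}"] by simp
    then interpret P2: base_edge2 V E u x y v "{a. H a v}" "{b. H b u}" "?C"
      by unfold_locales
    have "int (card {a. H a v}) + int (card {b. H b u}) = int (n - 2)"
      using neg le2[OF uv] P.deg_u P.deg_v by linarith
    hence "4 * (int (card {a. H a v}) * int (card {b. H b u})) \<le> int (n - 2) * int (n - 2)"
      using prod[of "card {a. H a v}" "card {b. H b u}"] by simp
    moreover have "int (\<Sum>p\<in>V. deg p) \<le> 2 * (int (card {a. H a v}) * int (card {b. H b u}))"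
      using P2.degree_sum_le2 by (metis of_nat_le_iff of_nat_mult of_nat_numeral)
    ultimately show False using big by linarith
  qed
  have "\<exists>u v. H u v \<and> deg u + deg v = n - 3"
  proof (rule ccontr)
    assume none: "\<not> ?thesis"
    have "deg u + deg v \<le> n - 4" if "H u v" for u v
    proof -
      have "deg u + deg v \<noteq> n - 3" using none that by blast
      thus ?thesis using le3[OF that] by linarith
    qed
    hence "2 * (\<Sum>p\<in>V. deg p) \<le> n * (n - 4)" unfolding n_def by (rule degree_sum_le)
    hence "2 * int (\<Sum>p\<in>V. deg p) \<le> int n * int (n - 4)"
      by (metis of_nat_le_iff of_nat_mult of_nat_numeral)
    moreover have "int n * int (n - 4) \<le> int (n - 2) * int (n - 2)"
      using n unfolding n_def by (simp add: of_nat_diff algebra_simps)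
    ultimately show False using big by linarith
  qed
  then obtain u v where uv: "H u v" "deg u + deg v = n - 3" by blast
  obtain x y where b: "base_edge V E u x y v {a. H a v} {b. H b u} (V - ({a. H a v} \<union> {b. H b u}))"
    using base[OF uv(1)] by blast
  define A where "A = {a. H a v}"
  define B where "B = {b. H b u}"
  define C where "C = V - (A \<union> B)"
  interpret P: base_edge V E u x y v A B C using b unfolding A_def B_def C_def .
  have xy: "x \<noteq> y" using P.Exy E_irrefl by blast
  have cAB: "card A + card B = n - 3" using uv P.deg_u P.deg_v by simp
  have "card C = 3" using P.card_V cAB n unfolding n_def by linarith
  hence "card (C - {x, y}) = 1" using P.xyC xy P.finite_ABC by (simp add: card_Diff_subset)
  then obtain z where "C - {x, y} = {z}" by (rule card_1_singletonE)
  hence C3: "C = {x, y, z}" "z \<noteq> x" "z \<noteq> y" using P.xyC by blast+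
  let ?kA = "\<Sum>a\<in>A. adj C a" and ?kB = "\<Sum>b\<in>B. adj C b"
  let ?e = "of_bool (H x z) + of_bool (H y z) :: nat"
  have kC: "(\<Sum>c\<in>C. adj C c) = 2 * ?e"
    using xy C3 H_irrefl P.not_Hxy H_commute[of y x] H_commute[of z x] H_commute[of z y]
    by (simp add: adj_insert adj_empty)
  have count: "int (\<Sum>p\<in>V. deg p) + 2 * int (miss A B)
      = 2 * (int (card A) * int (card B)) + 2 * int (?kA + ?kB + ?e)"
    using arg_cong[OF P.degree_count, of int] unfolding kC by simp
  have tot: "int (card A) + int (card B) = int n - 3" using cAB n unfolding n_def by linarith
  have n2: "int (n - 2) = int n - 2" using n unfolding n_def by linarith
  \<comment> \<open>The margin \<open>l\<close> will be \<open>card A\<close>, \<open>card B\<close>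
    or 7. The premise holds for the first two because \<open>card A + card B + 1 = n - 2\<close>,
    for the third because \<open>18 \<le> n\<close> gives \<open>28 \<le> 2 * n - 5\<close>.\<close>
  have key: "int (miss A B) < int (?kA + ?kB + ?e) - l"
    if "4 * (int (card A) * int (card B) + l) \<le> int (n - 2) * int (n - 2)" for l
  proof -
    define N where "N = int (n - 2) * int (n - 2)"
    define K where "K = int (?kA + ?kB + ?e)"
    define T where "T = int (\<Sum>p\<in>V. deg p)"
    define Q where "Q = int (card A) * int (card B)"
    show ?thesis
      using that count big unfolding N_def[symmetric] K_def[symmetric] T_def[symmetric] Q_def[symmetric]
      by presburger
  qed
  have exA: "int (miss A B) < int (?kA + ?kB + ?e) - int (card A)"
  proof (rule key)
    show "4 * (int (card A) * int (card B) + int (card A)) \<le> int (n - 2) * int (n - 2)"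
      using prod[of "card A" "card B + 1"] tot n2 by (simp add: algebra_simps)
  qed
  have exB: "int (miss A B) < int (?kA + ?kB + ?e) - int (card B)"
  proof (rule key)
    show "4 * (int (card A) * int (card B) + int (card B)) \<le> int (n - 2) * int (n - 2)"
      using prod[of "card A + 1" "card B"] tot n2 by (simp add: algebra_simps)
  qed
  have ex7: "int (miss A B) < int (?kA + ?kB + ?e) - 7"
  proof (rule key)
    have "4 * (int (card A) * int (card B)) \<le> (int n - 3) * (int n - 3)"
      using prod[of "card A" "card B"] tot by simp
    thus "4 * (int (card A) * int (card B) + 7) \<le> int (n - 2) * int (n - 2)"
      using n unfolding n2 n_def by (simp add: algebra_simps)
  qed
  interpret X: excess_edge V E u x y v A B C z
  proof unfold_locales
    show "C = {x, y, z}" "z \<noteq> x" "z \<noteq> y" by fact+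
    \<comment> \<open>By \<open>le3\<close>, \<open>deg a\<close> is at most \<open>card B\<close>,
      of which \<open>adj B a\<close> is used inside \<open>B\<close>.\<close>
    show "adj C a \<le> nonadj B a" if "a \<in> A" for a
      using le3[of a v] that P.deg_A[OF that] P.deg_v adj_nonadj[OF P.finite_ABC(2), of a] cAB
      unfolding A_def by auto
    show "adj C b \<le> nonadj A b" if "b \<in> B" for b
      using le3[of b u] that P.deg_B[OF that] P.deg_u adj_nonadj[OF P.finite_ABC(1), of b] cAB
      unfolding B_def by auto
    show "miss A B + card A + 1 \<le> ?kA + ?kB + ?e" using exA by linarith
    show "miss A B + card B + 1 \<le> ?kA + ?kB + ?e" using exB by linarith
    show "miss A B + 8 \<le> ?kA + ?kB + ?e" using ex7 by linarith
  qed
  show False by (rule X.impossible)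
qed

end

section \<open>Transfer to distance graphs\<close>

text \<open>Each unordered pair comes from two ordered ones, distinct by irreflexivity.\<close>

lemma card_symmetric_rel:
  assumes "finite R" "sym R" "irrefl R"
  shows "card R = 2 * card ((\<lambda>(p, q). {p, q}) ` R)"
proof -
  let ?f = "\<lambda>(p, q). {p, q}"
  have "card {r \<in> R. ?f r = e} = 2" if e: "e \<in> ?f ` R" for e
  proof -
    obtain p q where pq: "(p, q) \<in> R" "e = {p, q}" using e by auto
    have qp: "(q, p) \<in> R" using assms(2) pq(1) by (rule symD)
    have f: "?f r = e \<longleftrightarrow> r = (p, q) \<or> r = (q, p)" for r
      unfolding pq(2) by (cases r) (simp add: doubleton_eq_iff)
    have "{r \<in> R. ?f r = e} = {(p, q), (q, p)}"
      unfolding f using pq(1) qp by auto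
    moreover have "p \<noteq> q" using assms(3) pq(1) by (auto simp: irrefl_def)
    ultimately show ?thesis by simp
  qed
  hence "(\<Sum>e\<in>?f ` R. card {r \<in> R. ?f r = e}) = 2 * card (?f ` R)" by simp
  moreover have "(\<Sum>e\<in>?f ` R. card {r \<in> R. ?f r = e}) = card R"
    using sum.group[of R "?f ` R" ?f "\<lambda>_. 1::nat"] assms(1) by simp
  ultimately show ?thesis by simp
qed

lemma graph_free_K3_iff:
  assumes wf: "pair_wf_digraph D" and sym: "sym (parcs D)" and irr: "irrefl (parcs D)"
  shows "graph_free (complete_graph 3) D \<longleftrightarrow>
    (\<forall>a b c. (a, b) \<in> parcs D \<longrightarrow> (b, c) \<in> parcs D \<longrightarrow> (a, c) \<notin> parcs D)"
proof -
  let ?K = "with_proj (complete_graph 3)"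
  have wfK: "wf_digraph ?K" by unfold_locales (auto simp: complete_graph_def)
  have wfD: "wf_digraph (with_proj D)" using wf wf_digraph_wp_iff by blast
  have "\<exists>S. subgraph S (with_proj D) \<and> digraph_iso ?K S"
    if abc: "(a, b) \<in> parcs D" "(b, c) \<in> parcs D" "(a, c) \<in> parcs D" for a b c
  proof -
    define f :: "nat \<Rightarrow> 'a" where "f i = (if i = 0 then a else if i = 1 then b else c)" for i
    define h :: "(nat, nat \<times> nat, 'a, 'a \<times> 'a) digraph_isomorphism" where
      "h = \<lparr> iso_verts = f, iso_arcs = (\<lambda>(i, j). (f i, f j)), iso_head = snd, iso_tail = fst \<rparr>"
    have ne: "a \<noteq> b" "b \<noteq> c" "a \<noteq> c" using irr abc by (auto simp: irrefl_def)
    have inj: "inj_on f {..<3}" using ne by (auto simp: inj_on_def f_def)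
    have iso: "pre_digraph.digraph_isomorphism ?K h"
      unfolding pre_digraph.digraph_isomorphism_def
      using wfK inj by (auto simp: h_def complete_graph_def inj_on_def)
    have arcs: "(f i, f j) \<in> parcs D" if "i < 3" "j < 3" "i \<noteq> j" for i j
    proof -
      have "i = 0 \<or> i = 1 \<or> i = 2" "j = 0 \<or> j = 1 \<or> j = 2" using that by linarith+
      thus ?thesis using that(3) abc symD[OF sym abc(1)] symD[OF sym abc(2)] symD[OF sym abc(3)]
        unfolding f_def by auto
    qed
    have verts: "f i \<in> pverts D" for i
      using abc pair_wf_digraph.wellformed'[OF wf] by (auto simp: f_def)
    have "subgraph (app_iso h ?K) (with_proj D)"
      unfolding subgraph_def compatible_def
      using wfD arcs verts by (auto simp: h_def complete_graph_def wf_digraph_def)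
    thus ?thesis using iso unfolding digraph_iso_def by blast
  qed
  moreover have "\<exists>a b c. (a, b) \<in> parcs D \<and> (b, c) \<in> parcs D \<and> (a, c) \<in> parcs D"
    if S: "subgraph S (with_proj D)" "digraph_iso ?K S" for S
  proof -
    obtain h where h: "pre_digraph.digraph_isomorphism ?K h" "S = app_iso h ?K"
      using S(2) unfolding digraph_iso_def by blast
    \<comment> \<open>Compatibility with \<open>D\<close> forces the end maps to be the projections,
      so arcs are determined by the vertex map.\<close>
    have ht: "iso_tail h = fst" "iso_head h = snd"
      using S(1) h(2) unfolding subgraph_def compatible_def by auto
    have arc: "(iso_verts h i, iso_verts h j) \<in> parcs D" if "i < 3" "j < 3" "i \<noteq> j" for i j
    proof -
      have K: "(i, j) \<in> arcs ?K" using that by (simp add: complete_graph_def)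
      hence "iso_verts h i = fst (iso_arcs h (i, j))" "iso_verts h j = snd (iso_arcs h (i, j))"
        using h(1) ht unfolding pre_digraph.digraph_isomorphism_def by auto
      moreover have "iso_arcs h (i, j) \<in> parcs D"
        using K S(1) h(2) unfolding subgraph_def by auto
      ultimately show ?thesis by simp
    qed
    show ?thesis using arc[of 0 1] arc[of 1 2] arc[of 0 2] by auto
  qed
  ultimately show ?thesis unfolding graph_free_def by blast
qed

abbreviation arc_rel :: "'a pair_pre_digraph \<Rightarrow> 'a \<Rightarrow> 'a \<Rightarrow> bool" where
  "arc_rel G p q \<equiv> (p, q) \<in> parcs G"

context
  fixes G :: "'a pair_pre_digraph"
  assumes G: "pair_graph G"
begin

interpretation pair_graph G by (rule G)

lemma dist_three_arc_rel: "dist_three (pverts G) (arc_rel G)"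
proof
  show "finite (pverts G)" by (rule pair_finite_verts)
  show "p \<in> pverts G" if "arc_rel G p q" for p q using that by (rule in_arcsD1)
  show "arc_rel G q p" if "arc_rel G p q" for p q
    using that sym_arcs unfolding symmetric_def by (auto dest: symD)
  show "\<not> arc_rel G p p" for p using pair_no_loops[of "(p, p)"] by auto
qed

interpretation dist_three "pverts G" "arc_rel G" by (rule dist_three_arc_rel)

lemma awalk_Suc_iff:
  "(\<exists>p. awalk a p b \<and> length p = Suc k) \<longleftrightarrow> (\<exists>w. arc_rel G a w \<and> (\<exists>p. awalk w p b \<and> length p = k))"
proof
  assume "\<exists>p. awalk a p b \<and> length p = Suc k"
  then obtain r p where "awalk a (r # p) b" "length p = k" by (auto simp: length_Suc_conv)
  thus "\<exists>w. arc_rel G a w \<and> (\<exists>p. awalk w p b \<and> length p = k)"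
    by (cases r) (auto simp: awalk_Cons_iff)
next
  assume "\<exists>w. arc_rel G a w \<and> (\<exists>p. awalk w p b \<and> length p = k)"
  then obtain w p where "arc_rel G a w" "awalk w p b" "length p = k" by blast
  hence "awalk a ((a, w) # p) b \<and> length ((a, w) # p) = Suc k" by (simp add: awalk_Cons_iff)
  thus "\<exists>p. awalk a p b \<and> length p = Suc k" by blast
qed

text \<open>The distance is the least length of a walk, so it suffices to describe the walks of
  length at most three.\<close>

lemma graph_dist_3_iff: "graph_dist G a b = ereal (real 3) \<longleftrightarrow> H a b"
proof -
  have w0: "(\<exists>p. awalk c p b \<and> length p = 0) \<longleftrightarrow> c = b \<and> c \<in> pverts G" for c
    by (auto simp: awalk_Nil_iff)
  have V2: "w \<in> pverts G" if "arc_rel G c w" for c w using that by (rule in_arcsD2)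
  have w1: "(\<exists>p. awalk c p b \<and> length p = Suc 0) \<longleftrightarrow> arc_rel G c b" for c
    unfolding awalk_Suc_iff w0 using V2 by blast
  have w2: "(\<exists>p. awalk c p b \<and> length p = Suc (Suc 0)) \<longleftrightarrow> (\<exists>r. arc_rel G c r \<and> arc_rel G r b)" for c
    unfolding awalk_Suc_iff[of c b "Suc 0"] w1 ..
  have w3: "(\<exists>p. awalk a p b \<and> length p = 3) \<longleftrightarrow> (\<exists>r s. arc_rel G a r \<and> arc_rel G r s \<and> arc_rel G s b)"
    unfolding numeral_3_eq_3 awalk_Suc_iff[of a b "Suc (Suc 0)"] w2 by blast
  have "(\<forall>p. awalk a p b \<longrightarrow> 3 \<le> length p) \<longleftrightarrow>
    \<not> (\<exists>p. awalk a p b \<and> length p = 0) \<and> \<not> (\<exists>p. awalk a p b \<and> length p = Suc 0) \<and>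
    \<not> (\<exists>p. awalk a p b \<and> length p = Suc (Suc 0))"
    by (auto simp: numeral_3_eq_3 not_less_eq_eq le_Suc_eq)
      (metis One_nat_def Suc_1 le_Suc_eq le_zero_eq length_0_conv not_less_eq_eq)+
  also have "\<dots> \<longleftrightarrow> \<not> (a = b \<and> a \<in> pverts G) \<and> \<not> arc_rel G a b \<and> (\<forall>r. arc_rel G a r \<longrightarrow> \<not> arc_rel G r b)"
    unfolding w0 w1 w2 by blast
  finally show ?thesis
    unfolding graph_dist_eq_iff[OF G] w3 H_def using in_arcsD1 by blast
qed

lemma parcs_dist_graph: "parcs (dist_graph 3 G) = {(a, b). H a b}"
  unfolding dist_graph_def using graph_dist_3_iff H_in_V H_sym by fastforce

lemma dist_graph_wf:
  "pair_wf_digraph (dist_graph 3 G)" "sym (parcs (dist_graph 3 G))"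
  "irrefl (parcs (dist_graph 3 G))" "finite (parcs (dist_graph 3 G))"
proof -
  show "pair_wf_digraph (dist_graph 3 G)"
    by unfold_locales (auto simp: dist_graph_def)
  show "sym (parcs (dist_graph 3 G))"
    unfolding parcs_dist_graph by (auto intro!: symI H_sym)
  show "irrefl (parcs (dist_graph 3 G))"
    unfolding parcs_dist_graph using H_irrefl by (auto simp: irrefl_def)
  show "finite (parcs (dist_graph 3 G))"
    by (rule finite_subset[of _ "pverts G \<times> pverts G"]) (auto simp: dist_graph_def pair_finite_verts)
qed

lemma card_uedges_dist_graph: "2 * card (uedges (dist_graph 3 G)) = card {(a, b). H a b}"
  unfolding uedges_def using card_symmetric_rel[OF dist_graph_wf(4,2,3)] parcs_dist_graph by simp

lemma graph_free_dist_graph_iff: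
  "graph_free (complete_graph 3) (dist_graph 3 G) \<longleftrightarrow>
    (\<forall>a b c. H a b \<longrightarrow> H b c \<longrightarrow> \<not> H a c)"
  unfolding graph_free_K3_iff[OF dist_graph_wf(1-3)] parcs_dist_graph by simp

lemma uedges_upper_bound:
  assumes "graph_free (complete_graph 3) (dist_graph 3 G)" "18 \<le> card (pverts G)"
  shows "card (uedges (dist_graph 3 G)) \<le> (card (pverts G) - 2)\<^sup>2 div 4"
proof -
  interpret triangle_free_dist_three "pverts G" "arc_rel G"
    using assms(1) unfolding graph_free_dist_graph_iff by unfold_locales blast
  have "{(a, b). H a b} = Sigma (pverts G) (\<lambda>a. {b. H a b})"
    using H_in_V by auto
  hence "card {(a, b). H a b} = (\<Sum>a\<in>pverts G. deg a)"
    unfolding deg_def using finite_V finite_H by simp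
  thus ?thesis
    using degree_sum_bound[OF assms(2)] card_uedges_dist_graph by simp
qed

end

section \<open>Double brooms and the extremal value\<close>

text \<open>Adjacent hubs 0 and 1 carry \<open>k\<close> and \<open>l\<close> leaves; two leaves are
  at distance three iff they hang at different hubs.\<close>

definition double_broom :: "nat \<Rightarrow> nat \<Rightarrow> nat pair_pre_digraph" where
  "double_broom k l = \<lparr> pverts = {..<2 + k + l},
    parcs = (let R = {(0, 1)} \<union> {0} \<times> {2..<2 + k} \<union> {1} \<times> {2 + k..<2 + k + l} in R \<union> R\<inverse>) \<rparr>"

lemma double_broom_graph: "pair_graph (double_broom k l)"
proof
  have "sym (parcs (double_broom k l))"
    unfolding double_broom_def Let_def by (auto intro: symI)
  thus "symmetric (with_proj (double_broom k l))"
    by (simp add: symmetric_def)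
qed (auto simp: double_broom_def Let_def)

lemma arc_double_broom:
  "arc_rel (double_broom k l) p q \<longleftrightarrow>
    p = 0 \<and> q = 1 \<or> p = 1 \<and> q = 0 \<or> p = 0 \<and> q \<in> {2..<2 + k} \<or> q = 0 \<and> p \<in> {2..<2 + k} \<or>
    p = 1 \<and> q \<in> {2 + k..<2 + k + l} \<or> q = 1 \<and> p \<in> {2 + k..<2 + k + l}"
  by (auto simp: double_broom_def Let_def)

lemma dist_three_double_broom:
  "dist_three.H (arc_rel (double_broom k l)) p q \<longleftrightarrow>
    p \<in> {2..<2 + k} \<and> q \<in> {2 + k..<2 + k + l} \<or> q \<in> {2..<2 + k} \<and> p \<in> {2 + k..<2 + k + l}"
proof -
  interpret dist_three "pverts (double_broom k l)" "arc_rel (double_broom k l)"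
    by (rule dist_three_arc_rel[OF double_broom_graph])
  have *: "H p q" if "p \<in> {2..<2 + k}" "q \<in> {2 + k..<2 + k + l}" for p q
    unfolding H_def unfolding arc_double_broom
  proof (intro conjI)
    show "\<exists>r s. (p = 0 \<and> r = 1 \<or> p = 1 \<and> r = 0 \<or> p = 0 \<and> r \<in> {2..<2 + k} \<or> r = 0 \<and> p \<in> {2..<2 + k} \<or>
      p = 1 \<and> r \<in> {2 + k..<2 + k + l} \<or> r = 1 \<and> p \<in> {2 + k..<2 + k + l}) \<and>
      (r = 0 \<and> s = 1 \<or> r = 1 \<and> s = 0 \<or> r = 0 \<and> s \<in> {2..<2 + k} \<or> s = 0 \<and> r \<in> {2..<2 + k} \<or>
      r = 1 \<and> s \<in> {2 + k..<2 + k + l} \<or> s = 1 \<and> r \<in> {2 + k..<2 + k + l}) \<and>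
      (s = 0 \<and> q = 1 \<or> s = 1 \<and> q = 0 \<or> s = 0 \<and> q \<in> {2..<2 + k} \<or> q = 0 \<and> s \<in> {2..<2 + k} \<or>
      s = 1 \<and> q \<in> {2 + k..<2 + k + l} \<or> q = 1 \<and> s \<in> {2 + k..<2 + k + l})"
      using that by (intro exI[of _ 0] exI[of _ 1]) simp
  qed (use that in auto)
  have "p \<in> {2..<2 + k} \<and> q \<in> {2 + k..<2 + k + l} \<or> q \<in> {2..<2 + k} \<and> p \<in> {2 + k..<2 + k + l}" if h: "H p q"
  proof -
    have pq: "p \<noteq> q" "\<not> arc_rel (double_broom k l) p q"
      "\<And>r. arc_rel (double_broom k l) p r \<Longrightarrow> \<not> arc_rel (double_broom k l) r q"
      using h unfolding H_def by blast+
    have V: "p < 2 + k + l" "q < 2 + k + l"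
      using H_in_V[OF h] H_in_V[OF H_sym[OF h]] by (simp_all add: double_broom_def)
    have c: "r = 0 \<or> r = 1 \<or> r \<in> {2..<2 + k} \<or> r \<in> {2 + k..<2 + k + l}" if "r < 2 + k + l" for r
      using that by auto
    show ?thesis
      using c[OF V(1)] c[OF V(2)]
      by (elim disjE) (use pq(1,2) pq(3)[of 0] pq(3)[of 1] in \<open>simp_all add: arc_double_broom\<close>)
  qed
  thus ?thesis using * H_sym by blast
qed

lemma double_broom_extremal:
  "graph_free (complete_graph 3) (dist_graph 3 (double_broom k l))"
  "card (uedges (dist_graph 3 (double_broom k l))) = k * l"
proof -
  show "graph_free (complete_graph 3) (dist_graph 3 (double_broom k l))"
    unfolding graph_free_dist_graph_iff[OF double_broom_graph] dist_three_double_broom by auto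
  let ?A = "{2..<2 + k}" and ?B = "{2 + k..<2 + k + l}"
  have "{(p, q). dist_three.H (arc_rel (double_broom k l)) p q} = ?A \<times> ?B \<union> ?B \<times> ?A"
    unfolding dist_three_double_broom by auto
  moreover have "card (?A \<times> ?B \<union> ?B \<times> ?A) = card (?A \<times> ?B) + card (?B \<times> ?A)"
    by (intro card_Un_disjoint) auto
  ultimately show "card (uedges (dist_graph 3 (double_broom k l))) = k * l"
    using card_uedges_dist_graph[OF double_broom_graph, of k l] by (simp add: mult.commute)
qed

theorem theorem5:
  fixes n :: nat
  assumes "n \<ge> 18"
  shows "int (ex_dist 3 n (complete_graph 3)) = \<lfloor>((real n - 2) / 2)\<^sup>2\<rfloor>"
proof -
  define m where "m = n - 2"
  have n: "n = 2 + m div 2 + (m - m div 2)" using assms unfolding m_def by simp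
  let ?S = "{card (uedges (dist_graph 3 G)) | G :: nat pair_pre_digraph.
    pair_graph G \<and> card (pverts G) = n \<and> graph_free (complete_graph 3) (dist_graph 3 G)}"
  have upper: "c \<le> m\<^sup>2 div 4" if "c \<in> ?S" for c
    using that uedges_upper_bound assms unfolding m_def by blast
  \<comment> \<open>Splitting the \<open>m\<close> leaves as evenly as possible makes the product of
    the two parts meet the upper bound for both parities.\<close>
  have val: "(m div 2) * (m - m div 2) = m\<^sup>2 div 4"
  proof (cases "even m")
    case True
    then obtain j where "m = 2 * j" by blast
    thus ?thesis by (simp add: power2_eq_square)
  next
    case False
    then obtain j where j: "m = 2 * j + 1" by (rule oddE)
    have "m\<^sup>2 = 4 * (j * (j + 1)) + 1" unfolding j by (simp add: power2_eq_square algebra_simps)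
    hence "m\<^sup>2 div 4 = j * (j + 1)" by simp
    thus ?thesis using j by simp
  qed
  have "card (pverts (double_broom (m div 2) (m - m div 2))) = n"
    by (subst n) (simp add: double_broom_def)
  hence "m\<^sup>2 div 4 \<in> ?S"
    using double_broom_graph[of "m div 2" "m - m div 2"] double_broom_extremal[of "m div 2" "m - m div 2"] val
    by (intro CollectI exI[of _ "double_broom (m div 2) (m - m div 2)"]) simp
  moreover have "finite ?S" using upper by (intro finite_subset[of ?S "{..m\<^sup>2 div 4}"]) auto
  ultimately have "ex_dist 3 n (complete_graph 3) = m\<^sup>2 div 4"
    unfolding ex_dist_def using upper by (intro Max_eqI)
  moreover have "((real n - 2) / 2)\<^sup>2 = real (m\<^sup>2) / real 4"
    using assms by (simp add: m_def power_divide of_nat_diff)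
  ultimately show ?thesis
    by (simp only: floor_divide_of_nat_eq)
qed

end
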